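(* Let $\mathbf k$ be a field, let $\mathcal G$ be a finite categorical group with centre $\mathrm{End}_{\mathcal G}(\mathbf 1)=\mathbf k^\times$, given in skeletal form by a finite group $G$ and a normalised 3-cocycle $\alpha: G\times G\times G\to\mathbf k^\times$ (trivial $G$-action on $\mathbf k^\times$). Let $V$ be an object of a $\mathbf k$-linear strict 2-category $\mathcal C$ and let $\varrho:\mathcal G\to \mathrm{GL}(V)$ be a linear representation of $\mathcal G$ on $V$. Then the categorical character of $\varrho$, consisting of the vector spaces $X_\varrho(g)=\mathrm{2\text{-}Hom}_{\mathcal C}(1_V,\varrho(g))$ and the maps $\beta_{g,h}:X_\varrho(g)\to X_\varrho(hgh^{-1})$, is a representation of the inertia groupoid $\Pi_1\Lambda\mathcal G$ of $\mathcal G$. Explicitly, in terms of the description of $\Pi_1\Lambda\mathcal G$ as the central extension $\widetilde{\Lambda G}$ of $\Lambda G$ by $\mathbf k^\times$ recalled in the context: the assignment $g\mapsto X_\varrho(g)$ on objects and $(a,\,g\xrightarrow{h}hgh^{-1})\mapsto a\cdot\beta_{g,h}$ on arrows is a functor from $\widetilde{\Lambda G}$ to $\mathbf k$-vector spaces; that is, the $\beta_{g,h}$ are linear isomorphisms, $\beta_{g,1}=\mathrm{id}$, and for all $r,g,h\in G$ $$\frac{\alpha(h,grg^{-1},g)}{\alpha(hgrg^{-1}h^{-1},h,g)\cdot\alpha(h,g,r)}\cdot\beta_{grg^{-1},h}\circ\beta_{r,g}=\beta_{r,hg}.$$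
   Context: A categorical group (2-group) is a monoidal groupoid in which every object is weakly invertible. The skeletal 2-group $\mathcal G$ classified by $(G,\mathbf k^\times,\alpha)$, with trivial action, has object set $G$ with tensor product the group law, strict units, $\mathrm{Aut}(g)=\mathbf k^\times$ for every $g$, no morphisms between distinct objects, and associator $(g\bullet h)\bullet k\to g\bullet(h\bullet k)$ equal to $\alpha(g,h,k)\in\mathrm{Aut}(ghk)=\mathbf k^\times$. Normalised means $\alpha(g,h,k)=1$ if one of $g,h,k$ is $1$. A $\mathbf k$-linear strict 2-category is a strict 2-category whose 2-Hom sets are $\mathbf k$-vector spaces with bilinear compositions. $\mathrm{GL}(V)$ is the categorical group of weakly invertible 1-endomorphisms of $V$ and 2-isomorphisms between them. A linear representation $\varrho:\mathcal G\to\mathrm{GL}(V)$ is a strong monoidal functor for which $\mathbf k^\times$ acts by multiplication with scalars. For the skeletal $\mathcal G$ it consists of weakly invertible 1-morphisms $\varrho(g):V\to V$ ($g\in G$), 2-isomorphisms $\psi_{g,h}:\varrho(g)\varrho(h)\Rightarrow\varrho(gh)$ and $\psi_1:\varrho(1)\Rightarrow 1_V$ such that $\psi_{g,hk}\circ(\varrho(g)\psi_{h,k})=\alpha(g,h,k)\,\psi_{gh,k}\circ(\psi_{g,h}\varrho(k))$, $\psi_{1,g}=\psi_1\varrho(g)$ and $\psi_{g,1}=\varrho(g)\psi_1$ for all $g,h,k\in G$ (juxtaposition is horizontal composition/whiskering, $\circ$ is vertical composition). Categorical character: $X_\varrho(g)=\mathrm{2\text{-}Hom}_{\mathcal C}(1_V,\varrho(g))$,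 and for $\eta\in X_\varrho(g)$ the element $\beta_{g,h}(\eta)\in X_\varrho(hgh^{-1})$ is the vertical composite $$1_V\Rightarrow\varrho(h)\varrho(h^{-1})\xrightarrow{\varrho(h)\eta\varrho(h^{-1})}\varrho(h)\varrho(g)\varrho(h^{-1})\xrightarrow{\psi_{h,g}\varrho(h^{-1})}\varrho(hg)\varrho(h^{-1})\xrightarrow{\psi_{hgh^{-1},h}^{-1}\varrho(h^{-1})}\varrho(hgh^{-1})\varrho(h)\varrho(h^{-1})\Rightarrow\varrho(hgh^{-1}),$$ where the first arrow is $\psi_{h,h^{-1}}^{-1}\circ\psi_1^{-1}$ and the last is $\varrho(hgh^{-1})(\psi_1\circ\psi_{h,h^{-1}})$. Inertia groupoid: $\Lambda\mathcal G=\mathrm{Bicat}(\bullet/\!\!/\mathbb Z,\bullet/\!\!/\mathcal G)$ is the 2-groupoid of bifunctors, (pseudonatural) transformations and modifications between the one-object bicategories associated with the discrete 2-group $\mathbb Z$ and with $\mathcal G$. Here all its 2-morphisms are 2-automorphisms, and $\Pi_1\Lambda\mathcal G$ is the groupoid obtained by forgetting them. Let $\Lambda G$ be the groupoid with objects $g\in G$ and arrows $s:g\to sgs^{-1}$ ($s\in G$). $\Pi_1\Lambda\mathcal G$ is equivalent to the central extension $\widetilde{\Lambda G}$ whose objects are those of $\Lambda G$, whose arrows are $\mathbf k^\times\times\mathrm{Hom}_{\Lambda G}(g,h)$, and whose composition is $(b,h\xrightarrow{t}k)\circ(a,g\xrightarrow{s}h)=(\tau(\alpha)(g\xrightarrow{s}h\xrightarrow{t}k)\,ab,\;g\xrightarrow{ts}k)$,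 where $\tau(\alpha)(g\xrightarrow{s}h\xrightarrow{t}k)=\dfrac{\alpha(t,s,g)\,\alpha(k,t,s)}{\alpha(t,h,s)}$. A representation of the inertia groupoid is a functor from it to $\mathbf k$-vector spaces, with central $\mathbf k^\times$ acting by scalars. *)

theory Defs
  imports "HOL-Algebra.Module"
begin

section \<open>Linear maps\<close>

definition linear_map ::
  "('k, 'm) ring_scheme \<Rightarrow> ('k, 'a, 's) module_scheme \<Rightarrow> ('k, 'b, 't) module_scheme \<Rightarrow> ('a \<Rightarrow> 'b) \<Rightarrow> bool"
  where "linear_map K M N f \<longleftrightarrow>
    f \<in> carrier M \<rightarrow> carrier N \<and>
    (\<forall>x \<in> carrier M. \<forall>y \<in> carrier M. f (x \<oplus>\<^bsub>M\<^esub> y) = f x \<oplus>\<^bsub>N\<^esub> f y) \<and>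
    (\<forall>a \<in> carrier K. \<forall>x \<in> carrier M. f (a \<odot>\<^bsub>M\<^esub> x) = a \<odot>\<^bsub>N\<^esub> f x)"

definition linear_iso ::
  "('k, 'm) ring_scheme \<Rightarrow> ('k, 'a, 's) module_scheme \<Rightarrow> ('k, 'b, 't) module_scheme \<Rightarrow> ('a \<Rightarrow> 'b) \<Rightarrow> bool"
  where "linear_iso K M N f \<longleftrightarrow> linear_map K M N f \<and> bij_betw f (carrier M) (carrier N)"

definition bilinear_map ::
  "('k, 'm) ring_scheme \<Rightarrow> ('k, 'a, 's) module_scheme \<Rightarrow> ('k, 'b, 't) module_scheme \<Rightarrow>
   ('k, 'c, 'u) module_scheme \<Rightarrow> ('a \<Rightarrow> 'b \<Rightarrow> 'c) \<Rightarrow> bool"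
  where "bilinear_map K M N P b \<longleftrightarrow>
    (\<forall>x \<in> carrier M. linear_map K N P (b x)) \<and>
    (\<forall>y \<in> carrier N. linear_map K M P (\<lambda>x. b x y))"


section \<open>Categories and functors\<close>

text \<open>Composition is indexed by the three objects involved, so hom-sets need not be disjoint:
  \<open>Cmp C x y z g f\<close> is the composite of \<open>f : x \<rightarrow> y\<close> followed by \<open>g : y \<rightarrow> z\<close>.\<close>

record ('o, 'a) cat =
  Ob :: "'o set"
  Hom :: "'o \<Rightarrow> 'o \<Rightarrow> 'a set"
  Cmp :: "'o \<Rightarrow> 'o \<Rightarrow> 'o \<Rightarrow> 'a \<Rightarrow> 'a \<Rightarrow> 'a"
  Idt :: "'o \<Rightarrow> 'a"

locale category =
  fixes C :: "('o, 'a, 'z) cat_scheme"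
  assumes cmp_closed: "\<lbrakk>x \<in> Ob C; y \<in> Ob C; z \<in> Ob C; f \<in> Hom C x y; g \<in> Hom C y z\<rbrakk>
      \<Longrightarrow> Cmp C x y z g f \<in> Hom C x z"
    and idt_closed: "x \<in> Ob C \<Longrightarrow> Idt C x \<in> Hom C x x"
    and cmp_assoc: "\<lbrakk>w \<in> Ob C; x \<in> Ob C; y \<in> Ob C; z \<in> Ob C;
      f \<in> Hom C w x; g \<in> Hom C x y; h \<in> Hom C y z\<rbrakk>
      \<Longrightarrow> Cmp C w y z h (Cmp C w x y g f) = Cmp C w x z (Cmp C x y z h g) f"
    and cmp_idt_left: "\<lbrakk>x \<in> Ob C; y \<in> Ob C; f \<in> Hom C x y\<rbrakk> \<Longrightarrow> Cmp C x y y (Idt C y) f = f"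
    and cmp_idt_right: "\<lbrakk>x \<in> Ob C; y \<in> Ob C; f \<in> Hom C x y\<rbrakk> \<Longrightarrow> Cmp C x x y f (Idt C x) = f"

locale cat_functor = source: category C + target: category D
  for C :: "('o, 'a, 'z) cat_scheme" and D :: "('p, 'b, 'y) cat_scheme" +
  fixes F0 :: "'o \<Rightarrow> 'p" and F1 :: "'o \<Rightarrow> 'o \<Rightarrow> 'a \<Rightarrow> 'b"
  assumes map_ob: "x \<in> Ob C \<Longrightarrow> F0 x \<in> Ob D"
    and map_hom: "\<lbrakk>x \<in> Ob C; y \<in> Ob C; f \<in> Hom C x y\<rbrakk> \<Longrightarrow> F1 x y f \<in> Hom D (F0 x) (F0 y)"
    and map_idt: "x \<in> Ob C \<Longrightarrow> F1 x x (Idt C x) = Idt D (F0 x)"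
    and map_cmp: "\<lbrakk>x \<in> Ob C; y \<in> Ob C; z \<in> Ob C; f \<in> Hom C x y; g \<in> Hom C y z\<rbrakk>
      \<Longrightarrow> F1 x z (Cmp C x y z g f) = Cmp D (F0 x) (F0 y) (F0 z) (F1 y z g) (F1 x y f)"

text \<open>The category of \<open>K\<close>-vector spaces with underlying set in a given type. To make equality of
  arrows the equality of maps on the vector space, arrows are \<open>undefined\<close> off the carrier.\<close>

definition vect :: "('k, 'm) ring_scheme \<Rightarrow> (('k, 'v) module, 'v \<Rightarrow> 'v) cat"
  where "vect K = \<lparr>
    Ob = {M. module K M},
    Hom = (\<lambda>M N. {f \<in> extensional (carrier M). linear_map K M N f}),
    Cmp = (\<lambda>M N P g f. compose (carrier M) g f),
    Idt = (\<lambda>M. \<lambda>x \<in> carrier M. x) \<rparr>"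


section \<open>Linear strict 2-categories\<close>

text \<open>\<open>Comp1 C g f\<close> is the composite 1-morphism \<open>gf\<close>, with \<open>f\<close> applied first;
  \<open>Hom2 C f g\<close> is the vector space of 2-morphisms \<open>f \<Rightarrow> g\<close> (the \<open>mult\<close> and \<open>one\<close> fields of the
  module record play no role). Hom-sets are not required to be disjoint: a strict
  2-category with disjoint hom-sets is an instance, as its compositions are then determined by
  the cells alone.\<close>

record ('o, 'f, 'k, 'c) two_cat =
  Obj :: "'o set"
  Hom1 :: "'o \<Rightarrow> 'o \<Rightarrow> 'f set"
  Id1 :: "'o \<Rightarrow> 'f"
  Comp1 :: "'f \<Rightarrow> 'f \<Rightarrow> 'f"  (infixl \<open>\<diamondop>\<index>\<close> 75)
  Hom2 :: "'f \<Rightarrow> 'f \<Rightarrow> ('k, 'c) module"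
  Id2 :: "'f \<Rightarrow> 'c"
  Vert :: "'c \<Rightarrow> 'c \<Rightarrow> 'c"  (infixl \<open>\<bullet>\<index>\<close> 65)
  Horiz :: "'c \<Rightarrow> 'c \<Rightarrow> 'c"  (infixl \<open>\<star>\<index>\<close> 75)

locale linear_2_category = field K
  for K :: "('k, 'm) ring_scheme" +
  fixes C :: "('o, 'f, 'k, 'c, 'z) two_cat_scheme" (structure)
  assumes id1_closed: "x \<in> Obj C \<Longrightarrow> Id1 C x \<in> Hom1 C x x"
    and comp1_closed: "\<lbrakk>x \<in> Obj C; y \<in> Obj C; z \<in> Obj C; f \<in> Hom1 C x y; g \<in> Hom1 C y z\<rbrakk>
      \<Longrightarrow> g \<diamondop>\<^bsub>C\<^esub> f \<in> Hom1 C x z"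
    and comp1_assoc: "\<lbrakk>w \<in> Obj C; x \<in> Obj C; y \<in> Obj C; z \<in> Obj C;
      f \<in> Hom1 C w x; g \<in> Hom1 C x y; h \<in> Hom1 C y z\<rbrakk>
      \<Longrightarrow> (h \<diamondop>\<^bsub>C\<^esub> g) \<diamondop>\<^bsub>C\<^esub> f = h \<diamondop>\<^bsub>C\<^esub> (g \<diamondop>\<^bsub>C\<^esub> f)"
    and comp1_id_left: "\<lbrakk>x \<in> Obj C; y \<in> Obj C; f \<in> Hom1 C x y\<rbrakk> \<Longrightarrow> Id1 C y \<diamondop>\<^bsub>C\<^esub> f = f"
    and comp1_id_right: "\<lbrakk>x \<in> Obj C; y \<in> Obj C; f \<in> Hom1 C x y\<rbrakk> \<Longrightarrow> f \<diamondop>\<^bsub>C\<^esub> Id1 C x = f"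
    and hom2_module: "\<lbrakk>x \<in> Obj C; y \<in> Obj C; f \<in> Hom1 C x y; g \<in> Hom1 C x y\<rbrakk>
      \<Longrightarrow> module K (Hom2 C f g)"
    and id2_closed: "\<lbrakk>x \<in> Obj C; y \<in> Obj C; f \<in> Hom1 C x y\<rbrakk> \<Longrightarrow> Id2 C f \<in> carrier (Hom2 C f f)"
    and vert_bilinear: "\<lbrakk>x \<in> Obj C; y \<in> Obj C; f \<in> Hom1 C x y; g \<in> Hom1 C x y; h \<in> Hom1 C x y\<rbrakk>
      \<Longrightarrow> bilinear_map K (Hom2 C g h) (Hom2 C f g) (Hom2 C f h) (Vert C)"
    and vert_assoc: "\<lbrakk>x \<in> Obj C; y \<in> Obj C;
      f \<in> Hom1 C x y; g \<in> Hom1 C x y; h \<in> Hom1 C x y; k \<in> Hom1 C x y;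
      \<eta> \<in> carrier (Hom2 C f g); \<theta> \<in> carrier (Hom2 C g h); \<zeta> \<in> carrier (Hom2 C h k)\<rbrakk>
      \<Longrightarrow> (\<zeta> \<bullet>\<^bsub>C\<^esub> \<theta>) \<bullet>\<^bsub>C\<^esub> \<eta> = \<zeta> \<bullet>\<^bsub>C\<^esub> (\<theta> \<bullet>\<^bsub>C\<^esub> \<eta>)"
    and vert_id_left: "\<lbrakk>x \<in> Obj C; y \<in> Obj C; f \<in> Hom1 C x y; g \<in> Hom1 C x y;
      \<eta> \<in> carrier (Hom2 C f g)\<rbrakk> \<Longrightarrow> Id2 C g \<bullet>\<^bsub>C\<^esub> \<eta> = \<eta>"
    and vert_id_right: "\<lbrakk>x \<in> Obj C; y \<in> Obj C; f \<in> Hom1 C x y; g \<in> Hom1 C x y;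
      \<eta> \<in> carrier (Hom2 C f g)\<rbrakk> \<Longrightarrow> \<eta> \<bullet>\<^bsub>C\<^esub> Id2 C f = \<eta>"
    and horiz_bilinear: "\<lbrakk>x \<in> Obj C; y \<in> Obj C; z \<in> Obj C;
      f \<in> Hom1 C x y; f' \<in> Hom1 C x y; g \<in> Hom1 C y z; g' \<in> Hom1 C y z\<rbrakk>
      \<Longrightarrow> bilinear_map K (Hom2 C g g') (Hom2 C f f') (Hom2 C (g \<diamondop>\<^bsub>C\<^esub> f) (g' \<diamondop>\<^bsub>C\<^esub> f')) (Horiz C)"
    and horiz_assoc: "\<lbrakk>w \<in> Obj C; x \<in> Obj C; y \<in> Obj C; z \<in> Obj C;
      f \<in> Hom1 C w x; f' \<in> Hom1 C w x; g \<in> Hom1 C x y; g' \<in> Hom1 C x y; h \<in> Hom1 C y z; h' \<in> Hom1 C y z;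
      \<eta> \<in> carrier (Hom2 C f f'); \<theta> \<in> carrier (Hom2 C g g'); \<zeta> \<in> carrier (Hom2 C h h')\<rbrakk>
      \<Longrightarrow> (\<zeta> \<star>\<^bsub>C\<^esub> \<theta>) \<star>\<^bsub>C\<^esub> \<eta> = \<zeta> \<star>\<^bsub>C\<^esub> (\<theta> \<star>\<^bsub>C\<^esub> \<eta>)"
    and horiz_id_left: "\<lbrakk>x \<in> Obj C; y \<in> Obj C; f \<in> Hom1 C x y; g \<in> Hom1 C x y;
      \<eta> \<in> carrier (Hom2 C f g)\<rbrakk> \<Longrightarrow> Id2 C (Id1 C y) \<star>\<^bsub>C\<^esub> \<eta> = \<eta>"
    and horiz_id_right: "\<lbrakk>x \<in> Obj C; y \<in> Obj C; f \<in> Hom1 C x y; g \<in> Hom1 C x y;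
      \<eta> \<in> carrier (Hom2 C f g)\<rbrakk> \<Longrightarrow> \<eta> \<star>\<^bsub>C\<^esub> Id2 C (Id1 C x) = \<eta>"
    and horiz_id2: "\<lbrakk>x \<in> Obj C; y \<in> Obj C; z \<in> Obj C; f \<in> Hom1 C x y; g \<in> Hom1 C y z\<rbrakk>
      \<Longrightarrow> Id2 C g \<star>\<^bsub>C\<^esub> Id2 C f = Id2 C (g \<diamondop>\<^bsub>C\<^esub> f)"
    and interchange: "\<lbrakk>x \<in> Obj C; y \<in> Obj C; z \<in> Obj C;
      f \<in> Hom1 C x y; f' \<in> Hom1 C x y; f'' \<in> Hom1 C x y; g \<in> Hom1 C y z; g' \<in> Hom1 C y z; g'' \<in> Hom1 C y z;
      \<eta> \<in> carrier (Hom2 C f f'); \<eta>' \<in> carrier (Hom2 C f' f'');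
      \<theta> \<in> carrier (Hom2 C g g'); \<theta>' \<in> carrier (Hom2 C g' g'')\<rbrakk>
      \<Longrightarrow> (\<theta>' \<bullet>\<^bsub>C\<^esub> \<theta>) \<star>\<^bsub>C\<^esub> (\<eta>' \<bullet>\<^bsub>C\<^esub> \<eta>) = (\<theta>' \<star>\<^bsub>C\<^esub> \<eta>') \<bullet>\<^bsub>C\<^esub> (\<theta> \<star>\<^bsub>C\<^esub> \<eta>)"

definition inverse2 :: "('o, 'f, 'k, 'c, 'z) two_cat_scheme \<Rightarrow> 'f \<Rightarrow> 'f \<Rightarrow> 'c \<Rightarrow> 'c \<Rightarrow> bool"
  where "inverse2 C f g \<eta> \<theta> \<longleftrightarrow> \<theta> \<in> carrier (Hom2 C g f) \<and>
    \<theta> \<bullet>\<^bsub>C\<^esub> \<eta> = Id2 C f \<and> \<eta> \<bullet>\<^bsub>C\<^esub> \<theta> = Id2 C g"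

definition iso2 :: "('o, 'f, 'k, 'c, 'z) two_cat_scheme \<Rightarrow> 'f \<Rightarrow> 'f \<Rightarrow> 'c \<Rightarrow> bool"
  where "iso2 C f g \<eta> \<longleftrightarrow> \<eta> \<in> carrier (Hom2 C f g) \<and> (\<exists>\<theta>. inverse2 C f g \<eta> \<theta>)"

definition inv2 :: "('o, 'f, 'k, 'c, 'z) two_cat_scheme \<Rightarrow> 'f \<Rightarrow> 'f \<Rightarrow> 'c \<Rightarrow> 'c"
  where "inv2 C f g \<eta> = (THE \<theta>. inverse2 C f g \<eta> \<theta>)"

definition weakly_invertible :: "('o, 'f, 'k, 'c, 'z) two_cat_scheme \<Rightarrow> 'o \<Rightarrow> 'f \<Rightarrow> bool"
  where "weakly_invertible C V f \<longleftrightarrow> f \<in> Hom1 C V V \<and>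
    (\<exists>g \<in> Hom1 C V V. (\<exists>\<eta>. iso2 C (f \<diamondop>\<^bsub>C\<^esub> g) (Id1 C V) \<eta>) \<and> (\<exists>\<theta>. iso2 C (g \<diamondop>\<^bsub>C\<^esub> f) (Id1 C V) \<theta>))"

abbreviation whisker_left :: "('o, 'f, 'k, 'c, 'z) two_cat_scheme \<Rightarrow> 'f \<Rightarrow> 'c \<Rightarrow> 'c"
  where "whisker_left C f \<eta> \<equiv> Id2 C f \<star>\<^bsub>C\<^esub> \<eta>"

abbreviation whisker_right :: "('o, 'f, 'k, 'c, 'z) two_cat_scheme \<Rightarrow> 'c \<Rightarrow> 'f \<Rightarrow> 'c"
  where "whisker_right C \<eta> f \<equiv> \<eta> \<star>\<^bsub>C\<^esub> Id2 C f"


section \<open>Skeletal categorical groups and their linear representations\<close>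

text \<open>The skeletal categorical group with centre \<open>K\<^sup>\<times>\<close> is given by its data \<open>(G, \<alpha>)\<close>; the group
  \<open>K\<^sup>\<times>\<close> is \<open>Units K\<close>.\<close>

locale normalised_3_cocycle = field K + group G
  for K :: "('k, 'm) ring_scheme" and G :: "('g, 'n) monoid_scheme" +
  fixes \<alpha> :: "'g \<Rightarrow> 'g \<Rightarrow> 'g \<Rightarrow> 'k"
  assumes unit_valued: "\<lbrakk>g \<in> carrier G; h \<in> carrier G; k \<in> carrier G\<rbrakk> \<Longrightarrow> \<alpha> g h k \<in> Units K"
    and cocycle: "\<lbrakk>g \<in> carrier G; h \<in> carrier G; k \<in> carrier G; l \<in> carrier G\<rbrakk> \<Longrightarrow>
      \<alpha> h k l \<otimes>\<^bsub>K\<^esub> \<alpha> g (h \<otimes>\<^bsub>G\<^esub> k) l \<otimes>\<^bsub>K\<^esub> \<alpha> g h k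
        = \<alpha> (g \<otimes>\<^bsub>G\<^esub> h) k l \<otimes>\<^bsub>K\<^esub> \<alpha> g h (k \<otimes>\<^bsub>G\<^esub> l)"
    and normalised: "\<lbrakk>g \<in> carrier G; h \<in> carrier G; k \<in> carrier G;
      g = \<one>\<^bsub>G\<^esub> \<or> h = \<one>\<^bsub>G\<^esub> \<or> k = \<one>\<^bsub>G\<^esub>\<rbrakk> \<Longrightarrow> \<alpha> g h k = \<one>\<^bsub>K\<^esub>"

text \<open>In the skeletal model \<open>Aut(g) = K\<^sup>\<times>\<close> for every \<open>g\<close> and \<open>a \<in> K\<^sup>\<times>\<close> is sent to \<open>a\<close> times the
  identity 2-morphism of \<open>\<rho> g\<close>, so the functor on morphisms is not a separate datum.\<close>

locale linear_representation = linear_2_category K C + normalised_3_cocycle K G \<alpha>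
  for K :: "('k, 'm) ring_scheme" and G :: "('g, 'n) monoid_scheme"
    and \<alpha> :: "'g \<Rightarrow> 'g \<Rightarrow> 'g \<Rightarrow> 'k" and C :: "('o, 'f, 'k, 'c, 'z) two_cat_scheme" +
  fixes V :: 'o and \<rho> :: "'g \<Rightarrow> 'f" and \<psi> :: "'g \<Rightarrow> 'g \<Rightarrow> 'c" and \<psi>1 :: 'c
  assumes object: "V \<in> Obj C"
    and rho: "g \<in> carrier G \<Longrightarrow> weakly_invertible C V (\<rho> g)"
    and psi: "\<lbrakk>g \<in> carrier G; h \<in> carrier G\<rbrakk> \<Longrightarrow> iso2 C (\<rho> g \<diamondop>\<^bsub>C\<^esub> \<rho> h) (\<rho> (g \<otimes>\<^bsub>G\<^esub> h)) (\<psi> g h)"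
    and psi1: "iso2 C (\<rho> \<one>\<^bsub>G\<^esub>) (Id1 C V) \<psi>1"
    and psi_assoc: "\<lbrakk>g \<in> carrier G; h \<in> carrier G; k \<in> carrier G\<rbrakk> \<Longrightarrow>
      \<psi> g (h \<otimes>\<^bsub>G\<^esub> k) \<bullet>\<^bsub>C\<^esub> whisker_left C (\<rho> g) (\<psi> h k)
        = \<alpha> g h k \<odot>\<^bsub>Hom2 C (\<rho> g \<diamondop>\<^bsub>C\<^esub> \<rho> h \<diamondop>\<^bsub>C\<^esub> \<rho> k) (\<rho> (g \<otimes>\<^bsub>G\<^esub> h \<otimes>\<^bsub>G\<^esub> k))\<^esub>
            (\<psi> (g \<otimes>\<^bsub>G\<^esub> h) k \<bullet>\<^bsub>C\<^esub> whisker_right C (\<psi> g h) (\<rho> k))"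
    and psi_unit_left: "g \<in> carrier G \<Longrightarrow> \<psi> \<one>\<^bsub>G\<^esub> g = whisker_right C \<psi>1 (\<rho> g)"
    and psi_unit_right: "g \<in> carrier G \<Longrightarrow> \<psi> g \<one>\<^bsub>G\<^esub> = whisker_left C (\<rho> g) \<psi>1"


section \<open>The categorical character\<close>

abbreviation conjugate :: "('g, 'n) monoid_scheme \<Rightarrow> 'g \<Rightarrow> 'g \<Rightarrow> 'g"
  where "conjugate G s g \<equiv> s \<otimes>\<^bsub>G\<^esub> g \<otimes>\<^bsub>G\<^esub> inv\<^bsub>G\<^esub> s"

definition char_space :: "('o, 'f, 'k, 'c, 'z) two_cat_scheme \<Rightarrow> 'o \<Rightarrow> ('g \<Rightarrow> 'f) \<Rightarrow> 'g \<Rightarrow> ('k, 'c) module"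
  where "char_space C V \<rho> g = Hom2 C (Id1 C V) (\<rho> g)"

text \<open>\<open>char_map \<dots> g h\<close> is \<open>\<beta>\<^sub>g\<^sub>,\<^sub>h : X(g) \<rightarrow> X(hgh\<inverse>)\<close>; the vertical composite is written from
  the last arrow to the first.\<close>

definition char_map ::
  "('g, 'n) monoid_scheme \<Rightarrow> ('o, 'f, 'k, 'c, 'z) two_cat_scheme \<Rightarrow> 'o \<Rightarrow> ('g \<Rightarrow> 'f) \<Rightarrow> ('g \<Rightarrow> 'g \<Rightarrow> 'c) \<Rightarrow> 'c \<Rightarrow>
   'g \<Rightarrow> 'g \<Rightarrow> 'c \<Rightarrow> 'c"
  where "char_map G C V \<rho> \<psi> \<psi>1 g h \<eta> = (let h' = inv\<^bsub>G\<^esub> h; c = conjugate G h g in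
      whisker_left C (\<rho> c) (\<psi>1 \<bullet>\<^bsub>C\<^esub> \<psi> h h')
    \<bullet>\<^bsub>C\<^esub> whisker_right C (inv2 C (\<rho> c \<diamondop>\<^bsub>C\<^esub> \<rho> h) (\<rho> (h \<otimes>\<^bsub>G\<^esub> g)) (\<psi> c h)) (\<rho> h')
    \<bullet>\<^bsub>C\<^esub> whisker_right C (\<psi> h g) (\<rho> h')
    \<bullet>\<^bsub>C\<^esub> whisker_right C (whisker_left C (\<rho> h) \<eta>) (\<rho> h')
    \<bullet>\<^bsub>C\<^esub> (inv2 C (\<rho> h \<diamondop>\<^bsub>C\<^esub> \<rho> h') (\<rho> \<one>\<^bsub>G\<^esub>) (\<psi> h h') \<bullet>\<^bsub>C\<^esub> inv2 C (\<rho> \<one>\<^bsub>G\<^esub>) (Id1 C V) \<psi>1))"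


section \<open>The inertia groupoid and its representations\<close>

definition inertia_hom :: "('g, 'n) monoid_scheme \<Rightarrow> 'g \<Rightarrow> 'g \<Rightarrow> 'g set"
  where "inertia_hom G g h = {s \<in> carrier G. conjugate G s g = h}"

text \<open>\<open>transgression K \<alpha> g h k s t\<close> is \<open>\<tau>(\<alpha>)\<close> of the composable pair \<open>s : g \<rightarrow> h\<close>, \<open>t : h \<rightarrow> k\<close>.\<close>

definition transgression ::
  "('k, 'm) ring_scheme \<Rightarrow> ('g \<Rightarrow> 'g \<Rightarrow> 'g \<Rightarrow> 'k) \<Rightarrow> 'g \<Rightarrow> 'g \<Rightarrow> 'g \<Rightarrow> 'g \<Rightarrow> 'g \<Rightarrow> 'k"
  where "transgression K \<alpha> g h k s t = \<alpha> t s g \<otimes>\<^bsub>K\<^esub> \<alpha> k t s \<otimes>\<^bsub>K\<^esub> inv\<^bsub>K\<^esub> (\<alpha> t h s)"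

text \<open>The inertia groupoid of the skeletal categorical group \<open>(G, \<alpha>)\<close> (bifunctors out of the
  one-object bicategory of the discrete 2-group of integers, 2-morphisms forgotten), in its
  description as the central extension by \<open>K\<^sup>\<times>\<close>, twisted by \<open>\<tau>(\<alpha>)\<close>, of the inertia groupoid of
  \<open>G\<close>.\<close>

definition inertia_extension ::
  "('k, 'm) ring_scheme \<Rightarrow> ('g, 'n) monoid_scheme \<Rightarrow> ('g \<Rightarrow> 'g \<Rightarrow> 'g \<Rightarrow> 'k) \<Rightarrow> ('g, 'k \<times> 'g) cat"
  where "inertia_extension K G \<alpha> = \<lparr>
    Ob = carrier G,
    Hom = (\<lambda>g h. Units K \<times> inertia_hom G g h),
    Cmp = (\<lambda>g h k (b, t) (a, s). (transgression K \<alpha> g h k s t \<otimes>\<^bsub>K\<^esub> (a \<otimes>\<^bsub>K\<^esub> b), t \<otimes>\<^bsub>G\<^esub> s)),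
    Idt = (\<lambda>g. (\<one>\<^bsub>K\<^esub>, \<one>\<^bsub>G\<^esub>)) \<rparr>"

text \<open>The assumption says that the central subgroup \<open>K\<^sup>\<times>\<close> of each automorphism group acts by
  scalars.\<close>

locale inertia_representation = cat_functor "inertia_extension K G \<alpha>" "vect K" X A
  for K :: "('k, 'm) ring_scheme" and G :: "('g, 'n) monoid_scheme"
    and \<alpha> :: "'g \<Rightarrow> 'g \<Rightarrow> 'g \<Rightarrow> 'k"
    and X :: "'g \<Rightarrow> ('k, 'v) module" and A :: "'g \<Rightarrow> 'g \<Rightarrow> 'k \<times> 'g \<Rightarrow> 'v \<Rightarrow> 'v" +
  assumes central_scalar: "\<lbrakk>g \<in> carrier G; a \<in> Units K; x \<in> carrier (X g)\<rbrakk>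
    \<Longrightarrow> A g g (a, \<one>\<^bsub>G\<^esub>) x = a \<odot>\<^bsub>X g\<^esub> x"

end

theory Submission
  imports Defs
begin

text \<open>The element \<open>\<beta>\<^sub>g\<^sub>,\<^sub>h(\<eta>)\<close> is the unique 2-morphism \<open>\<xi> : 1 \<Rightarrow> \<rho>(hgh\<inverse>)\<close> with
  \<open>\<psi> \<circ> \<xi>\<rho>(h) = \<psi> \<circ> \<rho>(h)\<eta>\<close> as 2-morphisms \<open>\<rho>(h) \<Rightarrow> \<rho>(hg)\<close>. It solves this equation because
  \<open>\<rho>(h)\<close> and \<open>\<rho>(h\<inverse>)\<close> satisfy the zigzag identity up to a scalar, and the solution is unique
  because whiskering with the weakly invertible \<open>\<rho>(h)\<close> is faithful. Linearity, the unit law and the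
  composition law all follow by checking this equation; the three scalars of the composition law
  come from three uses of the associativity of \<open>\<psi>\<close>.\<close>

text \<open>The composite that defines \<open>char_map\<close> contains an inverse of \<psi> and a
  pair of mutually inverse cells between the identity and \<rho>(h)\<rho>(h\<inverse>), so two such
  composites do not paste together directly. The equation involves only \<psi> and whiskering, and
  the equations for g and for h paste to the one for hg. A functor needs a category as its source,
  and this is a matter of \<alpha> alone: the twisted composition is associative because the
  transgression is a 2-cocycle on the groupoid \<Lambda>G, and unital because \<alpha> is
  normalised. Bijectivity needs no separate construction of an inverse: the composition law for h
  and h\<inverse> makes the two maps inverse to each other up to units of the field.\<close>

section \<open>Linear maps and the category of vector spaces\<close>

lemma linear_mapD:
  assumes "linear_map K M N f"
  shows "x \<in> carrier M \<Longrightarrow> f x \<in> carrier N"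
    and "\<lbrakk>x \<in> carrier M; y \<in> carrier M\<rbrakk> \<Longrightarrow> f (x \<oplus>\<^bsub>M\<^esub> y) = f x \<oplus>\<^bsub>N\<^esub> f y"
    and "\<lbrakk>a \<in> carrier K; x \<in> carrier M\<rbrakk> \<Longrightarrow> f (a \<odot>\<^bsub>M\<^esub> x) = a \<odot>\<^bsub>N\<^esub> f x"
  using assms by (auto simp: linear_map_def)

lemma linear_map_comp:
  assumes "linear_map K M N f" "linear_map K N P g"
  shows "linear_map K M P (\<lambda>x. g (f x))"
  using assms by (auto simp: linear_map_def Pi_iff)

text \<open>Scalars commute with each other, so a multiple of a linear map is linear. An arrow with
  first component \<open>a\<close> acts by such a multiple.\<close>

lemma linear_map_smult:
  assumes "module K N" "linear_map K M N f" "a \<in> carrier K"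
  shows "linear_map K M N (\<lambda>x. a \<odot>\<^bsub>N\<^esub> f x)"
proof -
  interpret N: module K N by fact
  show ?thesis
    using assms(2,3)
    by (auto simp: linear_map_def Pi_iff N.smult_r_distr N.smult_assoc1[symmetric] N.R.m_comm)
qed

text \<open>Arrows of \<open>vect\<close> are \<open>undefined\<close> off the carrier, so a linear
  map has to be cut down before it can serve as one.\<close>

lemma linear_map_restrict:
  assumes "module K M" "linear_map K M N f"
  shows "linear_map K M N (restrict f (carrier M))"
proof -
  interpret M: module K M by fact
  show ?thesis
    using assms(2) by (auto simp: linear_map_def Pi_iff)
qed

lemma (in module) smult_Units_inv:
  "\<lbrakk>a \<in> Units R; x \<in> carrier M\<rbrakk> \<Longrightarrow> inv a \<odot>\<^bsub>M\<^esub> (a \<odot>\<^bsub>M\<^esub> x) = x"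
  by (simp add: smult_assoc1[symmetric] R.Units_closed)

lemma category_vect:
  fixes K :: "('k, 'm) ring_scheme"
  shows "category (vect K :: (('k, 'v) module, 'v \<Rightarrow> 'v) cat)"
proof
  fix M N P :: "('k, 'v) module" and f g
  assume "M \<in> Ob (vect K)" "f \<in> Hom (vect K) M N" "g \<in> Hom (vect K) N P"
  then show "Cmp (vect K) M N P g f \<in> Hom (vect K) M P"
    using linear_map_restrict[OF _ linear_map_comp, of K M N f P g]
    by (simp add: vect_def compose_def)
next
  fix M :: "('k, 'v) module"
  assume "M \<in> Ob (vect K)"
  then show "Idt (vect K) M \<in> Hom (vect K) M M"
    using linear_map_restrict[of K M M "\<lambda>x. x"] by (simp add: vect_def linear_map_def)
next
  fix M N P Q :: "('k, 'v) module" and f g h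
  assume "f \<in> Hom (vect K) M N"
  then show "Cmp (vect K) M P Q h (Cmp (vect K) M N P g f) = Cmp (vect K) M N Q (Cmp (vect K) N P Q h g) f"
    by (auto simp: vect_def compose_def linear_map_def Pi_iff fun_eq_iff)
next
  fix M N :: "('k, 'v) module" and f
  assume "f \<in> Hom (vect K) M N"
  then show "Cmp (vect K) M N N (Idt (vect K) N) f = f" "Cmp (vect K) M M N f (Idt (vect K) M) = f"
    by (auto simp: vect_def compose_def linear_map_def Pi_iff fun_eq_iff extensional_def)
qed


section \<open>The 2-cells between endomorphisms of an object\<close>

locale linear_2_category_at = linear_2_category K C
  for K :: "('k, 'm) ring_scheme" and C :: "('o, 'f, 'k, 'c, 'z) two_cat_scheme" (structure) +
  fixes V :: 'o
  assumes object: "V \<in> Obj C"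
begin

abbreviation E :: "'f set"
  where "E \<equiv> Hom1 C V V"

abbreviation I :: 'f
  where "I \<equiv> Id1 C V"

abbreviation wl (infixr \<open>\<triangleright>\<close> 76)
  where "f \<triangleright> \<eta> \<equiv> whisker_left C f \<eta>"

abbreviation wr (infixl \<open>\<triangleleft>\<close> 76)
  where "\<eta> \<triangleleft> f \<equiv> whisker_right C \<eta> f"

text \<open>Hom-spaces may overlap, so a 2-cell does not determine its source and target. This
  typing judgement carries both, so that one premise types a cell completely.\<close>

definition cell :: "'f \<Rightarrow> 'f \<Rightarrow> 'c \<Rightarrow> bool"
  where "cell f g \<eta> \<longleftrightarrow> f \<in> E \<and> g \<in> E \<and> \<eta> \<in> carrier (Hom2 C f g)"

lemma cellD: "cell f g \<eta> \<Longrightarrow> f \<in> E" "cell f g \<eta> \<Longrightarrow> g \<in> E" "cell f g \<eta> \<Longrightarrow> \<eta> \<in> carrier (Hom2 C f g)"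
  by (auto simp: cell_def)

lemma I_closed [simp]: "I \<in> E"
  using id1_closed object by blast

lemma comp_closed [simp]: "\<lbrakk>f \<in> E; g \<in> E\<rbrakk> \<Longrightarrow> f \<diamondop> g \<in> E"
  using comp1_closed object by blast

lemma comp_assoc [simp]: "\<lbrakk>f \<in> E; g \<in> E; h \<in> E\<rbrakk> \<Longrightarrow> f \<diamondop> g \<diamondop> h = f \<diamondop> (g \<diamondop> h)"
  using comp1_assoc object by blast

lemma comp_I [simp]: "f \<in> E \<Longrightarrow> I \<diamondop> f = f" "f \<in> E \<Longrightarrow> f \<diamondop> I = f"
  using comp1_id_left comp1_id_right object by blast+

lemma module_Hom2: "\<lbrakk>f \<in> E; g \<in> E\<rbrakk> \<Longrightarrow> module K (Hom2 C f g)"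
  using hom2_module object by blast

lemma cell_Id2: "f \<in> E \<Longrightarrow> cell f f (Id2 C f)"
  using id2_closed object by (auto simp: cell_def)

lemma linear_vert_left: "\<lbrakk>cell g h \<theta>; f \<in> E\<rbrakk> \<Longrightarrow> linear_map K (Hom2 C f g) (Hom2 C f h) (\<lambda>\<eta>. \<theta> \<bullet> \<eta>)"
  using vert_bilinear[OF object object, of f g h] by (auto simp: cell_def bilinear_map_def)

lemma linear_vert_right: "\<lbrakk>cell f g \<eta>; h \<in> E\<rbrakk> \<Longrightarrow> linear_map K (Hom2 C g h) (Hom2 C f h) (\<lambda>\<theta>. \<theta> \<bullet> \<eta>)"
  using vert_bilinear[OF object object, of f g h] by (auto simp: cell_def bilinear_map_def)

lemma linear_wl:
  "\<lbrakk>f \<in> E; g \<in> E; h \<in> E\<rbrakk> \<Longrightarrow> linear_map K (Hom2 C g h) (Hom2 C (f \<diamondop> g) (f \<diamondop> h)) (\<lambda>\<eta>. f \<triangleright> \<eta>)"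
  using horiz_bilinear[OF object object object, of g h f f] id2_closed[OF object object, of f]
  by (auto simp: bilinear_map_def)

lemma linear_wr:
  "\<lbrakk>f \<in> E; g \<in> E; h \<in> E\<rbrakk> \<Longrightarrow> linear_map K (Hom2 C g h) (Hom2 C (g \<diamondop> f) (h \<diamondop> f)) (\<lambda>\<eta>. \<eta> \<triangleleft> f)"
  using horiz_bilinear[OF object object object, of f f g h] id2_closed[OF object object, of f]
  by (auto simp: bilinear_map_def)

lemma cell_vert: "\<lbrakk>cell g h \<theta>; cell f g \<eta>\<rbrakk> \<Longrightarrow> cell f h (\<theta> \<bullet> \<eta>)"
  using linear_mapD(1)[OF linear_vert_left, of g h \<theta> f \<eta>] by (auto simp: cell_def)

lemma cell_wl: "\<lbrakk>f \<in> E; cell g h \<eta>\<rbrakk> \<Longrightarrow> cell (f \<diamondop> g) (f \<diamondop> h) (f \<triangleright> \<eta>)"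
  using linear_mapD(1)[OF linear_wl, of f g h \<eta>] by (auto simp: cell_def)

lemma cell_wr: "\<lbrakk>f \<in> E; cell g h \<eta>\<rbrakk> \<Longrightarrow> cell (g \<diamondop> f) (h \<diamondop> f) (\<eta> \<triangleleft> f)"
  using linear_mapD(1)[OF linear_wr, of f g h \<eta>] by (auto simp: cell_def)

lemma cell_smult: "\<lbrakk>a \<in> carrier K; cell f g \<eta>\<rbrakk> \<Longrightarrow> cell f g (a \<odot>\<^bsub>Hom2 C f g\<^esub> \<eta>)"
  using module.smult_closed[OF module_Hom2] by (auto simp: cell_def)

lemma vassoc: "\<lbrakk>cell h k \<zeta>; cell g h \<theta>; cell f g \<eta>\<rbrakk> \<Longrightarrow> \<zeta> \<bullet> \<theta> \<bullet> \<eta> = \<zeta> \<bullet> (\<theta> \<bullet> \<eta>)"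
  using vert_assoc object by (auto simp: cell_def)

lemma vert_Id2: "cell f g \<eta> \<Longrightarrow> Id2 C g \<bullet> \<eta> = \<eta>" "cell f g \<eta> \<Longrightarrow> \<eta> \<bullet> Id2 C f = \<eta>"
  using vert_id_left vert_id_right object by (auto simp: cell_def)

lemma wl_vert: "\<lbrakk>f \<in> E; cell h k \<theta>; cell g h \<eta>\<rbrakk> \<Longrightarrow> f \<triangleright> (\<theta> \<bullet> \<eta>) = f \<triangleright> \<theta> \<bullet> f \<triangleright> \<eta>"
  using interchange[OF object object object, of g h k f f f \<eta> \<theta> "Id2 C f" "Id2 C f"]
    cell_Id2[of f] vert_Id2[of f f "Id2 C f"] by (auto simp: cell_def)

lemma wr_vert: "\<lbrakk>f \<in> E; cell h k \<theta>; cell g h \<eta>\<rbrakk> \<Longrightarrow> (\<theta> \<bullet> \<eta>) \<triangleleft> f = \<theta> \<triangleleft> f \<bullet> \<eta> \<triangleleft> f"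
  using interchange[OF object object object, of f f f g h k "Id2 C f" "Id2 C f" \<eta> \<theta>]
    cell_Id2[of f] vert_Id2[of f f "Id2 C f"] by (auto simp: cell_def)

text \<open>Both sides are the horizontal composite \<open>\<theta> \<star> \<eta>\<close>, with
  identities inserted in the two possible ways and pulled apart by interchange. Cells on different
  factors thus slide past each other.\<close>

lemma whisker_exchange:
  assumes "cell f f' \<eta>" "cell g g' \<theta>"
  shows "\<theta> \<triangleleft> f' \<bullet> g \<triangleright> \<eta> = g' \<triangleright> \<eta> \<bullet> \<theta> \<triangleleft> f"
proof -
  have "\<theta> \<triangleleft> f' \<bullet> g \<triangleright> \<eta> = (\<theta> \<bullet> Id2 C g) \<star> (Id2 C f' \<bullet> \<eta>)"
    using assms cell_Id2[of g] cell_Id2[of f']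
      interchange[OF object object object, of f f' f' g g g' \<eta> "Id2 C f'" "Id2 C g" \<theta>]
    by (auto simp: cell_def)
  also have "\<dots> = (Id2 C g' \<bullet> \<theta>) \<star> (\<eta> \<bullet> Id2 C f)"
    using vert_Id2 assms by metis
  also have "\<dots> = g' \<triangleright> \<eta> \<bullet> \<theta> \<triangleleft> f"
    using assms cell_Id2[of g'] cell_Id2[of f]
      interchange[OF object object object, of f f f' g g' g' "Id2 C f" \<eta> \<theta> "Id2 C g'"]
    by (auto simp: cell_def)
  finally show ?thesis .
qed

lemma wl_wl: "\<lbrakk>f \<in> E; g \<in> E; cell h k \<eta>\<rbrakk> \<Longrightarrow> f \<triangleright> (g \<triangleright> \<eta>) = (f \<diamondop> g) \<triangleright> \<eta>"
  using horiz_assoc[OF object object object object, of h k g g f f \<eta> "Id2 C g" "Id2 C f"]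
    cell_Id2[of f] cell_Id2[of g] horiz_id2[OF object object object, of g f]
  by (auto simp: cell_def)

lemma wr_wr: "\<lbrakk>f \<in> E; g \<in> E; cell h k \<eta>\<rbrakk> \<Longrightarrow> \<eta> \<triangleleft> f \<triangleleft> g = \<eta> \<triangleleft> (f \<diamondop> g)"
  using horiz_assoc[OF object object object object, of g g f f h k "Id2 C g" "Id2 C f" \<eta>]
    cell_Id2[of f] cell_Id2[of g] horiz_id2[OF object object object, of g f]
  by (auto simp: cell_def)

lemma wl_wr: "\<lbrakk>f \<in> E; g \<in> E; cell h k \<eta>\<rbrakk> \<Longrightarrow> (f \<triangleright> \<eta>) \<triangleleft> g = f \<triangleright> (\<eta> \<triangleleft> g)"
  using horiz_assoc[OF object object object object, of g g h k f f "Id2 C g" \<eta> "Id2 C f"]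
    cell_Id2[of f] cell_Id2[of g]
  by (auto simp: cell_def)

lemma wl_I: "cell f g \<eta> \<Longrightarrow> I \<triangleright> \<eta> = \<eta>"
  and wr_I: "cell f g \<eta> \<Longrightarrow> \<eta> \<triangleleft> I = \<eta>"
  using horiz_id_left horiz_id_right object by (auto simp: cell_def)

lemma wl_Id2: "\<lbrakk>f \<in> E; g \<in> E\<rbrakk> \<Longrightarrow> f \<triangleright> Id2 C g = Id2 C (f \<diamondop> g)"
  using horiz_id2 object by blast

lemma vert_smult_left:
  "\<lbrakk>a \<in> carrier K; cell g h \<theta>; cell f g \<eta>\<rbrakk>
    \<Longrightarrow> (a \<odot>\<^bsub>Hom2 C g h\<^esub> \<theta>) \<bullet> \<eta> = a \<odot>\<^bsub>Hom2 C f h\<^esub> (\<theta> \<bullet> \<eta>)"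
  using linear_mapD(3)[OF linear_vert_right, of f g \<eta> h a \<theta>] by (auto simp: cell_def)

lemma vert_smult_right:
  "\<lbrakk>a \<in> carrier K; cell g h \<theta>; cell f g \<eta>\<rbrakk>
    \<Longrightarrow> \<theta> \<bullet> (a \<odot>\<^bsub>Hom2 C f g\<^esub> \<eta>) = a \<odot>\<^bsub>Hom2 C f h\<^esub> (\<theta> \<bullet> \<eta>)"
  using linear_mapD(3)[OF linear_vert_left, of g h \<theta> f a \<eta>] by (auto simp: cell_def)

lemma wl_smult:
  "\<lbrakk>a \<in> carrier K; f \<in> E; cell g h \<eta>\<rbrakk>
    \<Longrightarrow> f \<triangleright> (a \<odot>\<^bsub>Hom2 C g h\<^esub> \<eta>) = a \<odot>\<^bsub>Hom2 C (f \<diamondop> g) (f \<diamondop> h)\<^esub> (f \<triangleright> \<eta>)"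
  using linear_mapD(3)[OF linear_wl, of f g h a \<eta>] by (auto simp: cell_def)

lemma wr_smult:
  "\<lbrakk>a \<in> carrier K; f \<in> E; cell g h \<eta>\<rbrakk>
    \<Longrightarrow> (a \<odot>\<^bsub>Hom2 C g h\<^esub> \<eta>) \<triangleleft> f = a \<odot>\<^bsub>Hom2 C (g \<diamondop> f) (h \<diamondop> f)\<^esub> (\<eta> \<triangleleft> f)"
  using linear_mapD(3)[OF linear_wr, of f g h a \<eta>] by (auto simp: cell_def)

section \<open>Inverse 2-cells, cancellation and faithful whiskering\<close>

text \<open>A two-sided inverse is unique by associativity, so the description in
  \<open>inv2\<close> denotes it.\<close>

lemma inverse2_inv2:
  assumes "f \<in> E" "g \<in> E" "iso2 C f g \<eta>"
  shows "inverse2 C f g \<eta> (inv2 C f g \<eta>)"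
proof -
  have \<eta>: "cell f g \<eta>" using assms by (simp add: cell_def iso2_def)
  have "\<theta> = \<theta>'" if "inverse2 C f g \<eta> \<theta>" "inverse2 C f g \<eta> \<theta>'" for \<theta> \<theta>'
  proof -
    have "cell g f \<theta>" "cell g f \<theta>'" using that assms by (auto simp: cell_def inverse2_def)
    then show ?thesis using that \<eta> vassoc vert_Id2 unfolding inverse2_def by metis
  qed
  then show ?thesis
    using assms(3) theI'[of "inverse2 C f g \<eta>"] unfolding iso2_def inv2_def by blast
qed

lemma inv2:
  assumes "f \<in> E" "g \<in> E" "iso2 C f g \<eta>"
  shows "cell f g \<eta>" "cell g f (inv2 C f g \<eta>)"
    "inv2 C f g \<eta> \<bullet> \<eta> = Id2 C f" "\<eta> \<bullet> inv2 C f g \<eta> = Id2 C g"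
  using inverse2_inv2[OF assms] assms by (auto simp: inverse2_def cell_def iso2_def)

lemma iso2_cancel_left:
  assumes "g \<in> E" "h \<in> E" "iso2 C g h \<theta>" "cell f g \<eta>" "cell f g \<eta>'" "\<theta> \<bullet> \<eta> = \<theta> \<bullet> \<eta>'"
  shows "\<eta> = \<eta>'"
proof -
  note i = inv2[OF assms(1-3)]
  have "\<zeta> = inv2 C g h \<theta> \<bullet> (\<theta> \<bullet> \<zeta>)" if "cell f g \<zeta>" for \<zeta>
    using vassoc[OF i(2,1) that] i(3) vert_Id2(1)[OF that] by simp
  then show ?thesis using assms(4-6) by metis
qed

lemma iso2_cancel_right:
  assumes "f \<in> E" "g \<in> E" "iso2 C f g \<theta>" "cell g h \<eta>" "cell g h \<eta>'" "\<eta> \<bullet> \<theta> = \<eta>' \<bullet> \<theta>"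
  shows "\<eta> = \<eta>'"
proof -
  note i = inv2[OF assms(1-3)]
  have "\<zeta> = \<zeta> \<bullet> \<theta> \<bullet> inv2 C f g \<theta>" if "cell g h \<zeta>" for \<zeta>
    using vassoc[OF that i(1,2)] i(4) vert_Id2(2)[OF that] by simp
  then show ?thesis using assms(4-6) by metis
qed

text \<open>Whiskering once more by \<open>h'\<close> and closing up with \<epsilon> and \<epsilon>'
  recovers a cell: \<epsilon> slides past it and then cancels against \<epsilon>'. The cell is
  therefore a function of its whiskering by \<open>h\<close>.\<close>

lemma wr_faithful:
  assumes h: "h \<in> E" and h': "h' \<in> E" and e: "cell (h \<diamondop> h') I \<epsilon>" and e': "cell I (h \<diamondop> h') \<epsilon>'"
    and ee: "\<epsilon> \<bullet> \<epsilon>' = Id2 C I"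
    and x: "cell f g \<xi>" and y: "cell f g \<xi>'" and eq: "\<xi> \<triangleleft> h = \<xi>' \<triangleleft> h"
  shows "\<xi> = \<xi>'"
proof -
  have f: "f \<in> E" and g: "g \<in> E" using x by (auto simp: cell_def)
  have fe: "cell (f \<diamondop> (h \<diamondop> h')) f (f \<triangleright> \<epsilon>)" "cell f (f \<diamondop> (h \<diamondop> h')) (f \<triangleright> \<epsilon>')"
    using cell_wl[OF f e] cell_wl[OF f e'] f by auto
  have "\<zeta> = g \<triangleright> \<epsilon> \<bullet> \<zeta> \<triangleleft> h \<triangleleft> h' \<bullet> f \<triangleright> \<epsilon>'" if z: "cell f g \<zeta>" for \<zeta>
  proof -
    have "\<zeta> = \<zeta> \<bullet> (f \<triangleright> \<epsilon> \<bullet> f \<triangleright> \<epsilon>')"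
      using wl_vert[OF f e e'] ee wl_Id2[OF f I_closed] vert_Id2[OF z] f by simp
    also have "\<dots> = (\<zeta> \<triangleleft> I \<bullet> f \<triangleright> \<epsilon>) \<bullet> f \<triangleright> \<epsilon>'"
      using vassoc[OF z fe] wr_I[OF z] by simp
    also have "\<zeta> \<triangleleft> I \<bullet> f \<triangleright> \<epsilon> = g \<triangleright> \<epsilon> \<bullet> \<zeta> \<triangleleft> h \<triangleleft> h'"
      using whisker_exchange[OF e z] wr_wr[OF h h' z] by simp
    finally show ?thesis .
  qed
  then show ?thesis using x y eq by metis
qed

text \<open>The usual bijection between 2-morphisms \<open>I \<Rightarrow> c\<close> and \<open>f \<Rightarrow> cf\<close> does not need the exact zigzag
  identity: a scalar \<open>a\<close> moves past \<open>\<Phi>\<close> by bilinearity, so it never has to be evaluated.\<close>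

lemma zigzag:
  assumes f: "f \<in> E" and f': "f' \<in> E" and c: "c \<in> E" and F: "cell f (c \<diamondop> f) \<Phi>"
    and e: "cell (f \<diamondop> f') I \<epsilon>" and ei: "cell I (f \<diamondop> f') \<epsilon>i" and inv: "\<epsilon>i \<bullet> \<epsilon> = Id2 C (f \<diamondop> f')"
      "\<epsilon> \<bullet> \<epsilon>i = Id2 C I"
    and e': "cell (f' \<diamondop> f) I \<epsilon>'" and a: "a \<in> carrier K"
    and zz: "\<epsilon> \<triangleleft> f = a \<odot>\<^bsub>Hom2 C (f \<diamondop> (f' \<diamondop> f)) f\<^esub> (f \<triangleright> \<epsilon>')"
  shows "cell I c (c \<triangleright> \<epsilon> \<bullet> \<Phi> \<triangleleft> f' \<bullet> \<epsilon>i)" "(c \<triangleright> \<epsilon> \<bullet> \<Phi> \<triangleleft> f' \<bullet> \<epsilon>i) \<triangleleft> f = \<Phi>"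
proof -
  have ce: "cell (c \<diamondop> (f \<diamondop> f')) c (c \<triangleright> \<epsilon>)"
    using cell_wl[OF c e] c by simp
  have Ff: "cell (f \<diamondop> f') (c \<diamondop> (f \<diamondop> f')) (\<Phi> \<triangleleft> f')"
    using cell_wr[OF f' F] c f f' by simp
  have ceF: "cell (f \<diamondop> f') c (c \<triangleright> \<epsilon> \<bullet> \<Phi> \<triangleleft> f')"
    using cell_vert[OF ce Ff] .
  show "cell I c (c \<triangleright> \<epsilon> \<bullet> \<Phi> \<triangleleft> f' \<bullet> \<epsilon>i)"
    using cell_vert[OF ceF ei] .
  have fe': "cell (f \<diamondop> (f' \<diamondop> f)) f (f \<triangleright> \<epsilon>')"
    using cell_wl[OF f e'] f by simp
  have cfe': "cell (c \<diamondop> (f \<diamondop> (f' \<diamondop> f))) (c \<diamondop> f) ((c \<diamondop> f) \<triangleright> \<epsilon>')"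
    using cell_wl[OF _ e', of "c \<diamondop> f"] c f f' by simp
  have Fff: "cell (f \<diamondop> (f' \<diamondop> f)) (c \<diamondop> (f \<diamondop> (f' \<diamondop> f))) (\<Phi> \<triangleleft> (f' \<diamondop> f))"
    using cell_wr[OF _ F, of "f' \<diamondop> f"] c f f' by simp
  have eif: "cell f (f \<diamondop> (f' \<diamondop> f)) (\<epsilon>i \<triangleleft> f)"
    using cell_wr[OF f ei] f f' by simp
  have ef: "cell (f \<diamondop> (f' \<diamondop> f)) f (\<epsilon> \<triangleleft> f)"
    using cell_wr[OF f e] f f' by simp
  \<comment> \<open>\<epsilon> consumes the factor \<open>f\<close> that \<Phi> produces, so it
    cannot slide past \<Phi>. \<epsilon>' acts only on the two factors to the right of \<Phi> and
    can; \<open>zz\<close> trades one for the other.\<close>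
  have "(c \<triangleright> \<epsilon>) \<triangleleft> f = a \<odot>\<^bsub>Hom2 C (c \<diamondop> (f \<diamondop> (f' \<diamondop> f))) (c \<diamondop> f)\<^esub> ((c \<diamondop> f) \<triangleright> \<epsilon>')"
    using wl_wr[OF c f e] zz wl_smult[OF a c fe'] wl_wl[OF c f e'] by simp
  moreover have "\<Phi> \<triangleleft> f' \<triangleleft> f = \<Phi> \<triangleleft> (f' \<diamondop> f)"
    using wr_wr[OF f' f F] .
  ultimately have "(c \<triangleright> \<epsilon> \<bullet> \<Phi> \<triangleleft> f') \<triangleleft> f
      = (a \<odot>\<^bsub>Hom2 C (c \<diamondop> (f \<diamondop> (f' \<diamondop> f))) (c \<diamondop> f)\<^esub> ((c \<diamondop> f) \<triangleright> \<epsilon>')) \<bullet> \<Phi> \<triangleleft> (f' \<diamondop> f)"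
    using wr_vert[OF f ce Ff] by simp
  also have "\<dots> = a \<odot>\<^bsub>Hom2 C (f \<diamondop> (f' \<diamondop> f)) (c \<diamondop> f)\<^esub> ((c \<diamondop> f) \<triangleright> \<epsilon>' \<bullet> \<Phi> \<triangleleft> (f' \<diamondop> f))"
    using vert_smult_left[OF a cfe' Fff] .
  also have "(c \<diamondop> f) \<triangleright> \<epsilon>' \<bullet> \<Phi> \<triangleleft> (f' \<diamondop> f) = \<Phi> \<bullet> f \<triangleright> \<epsilon>'"
    using whisker_exchange[OF e' F] wr_I[OF F] by simp
  \<comment> \<open>Read in the other direction, \<open>zz\<close> absorbs the scalar and brings
    \<epsilon> back, now next to its inverse.\<close>
  also have "a \<odot>\<^bsub>Hom2 C (f \<diamondop> (f' \<diamondop> f)) (c \<diamondop> f)\<^esub> (\<Phi> \<bullet> f \<triangleright> \<epsilon>') = \<Phi> \<bullet> \<epsilon> \<triangleleft> f"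
    using vert_smult_right[OF a F fe'] zz by simp
  finally have "(c \<triangleright> \<epsilon> \<bullet> \<Phi> \<triangleleft> f' \<bullet> \<epsilon>i) \<triangleleft> f = \<Phi> \<bullet> \<epsilon> \<triangleleft> f \<bullet> \<epsilon>i \<triangleleft> f"
    using wr_vert[OF f ceF ei] by simp
  also have "\<dots> = \<Phi> \<bullet> (\<epsilon> \<bullet> \<epsilon>i) \<triangleleft> f"
    using vassoc[OF F ef eif] wr_vert[OF f e ei] by simp
  also have "\<dots> = \<Phi>"
    using inv(2) horiz_id2[OF object object object f I_closed] f vert_Id2[OF F] by simp
  finally show "(c \<triangleright> \<epsilon> \<bullet> \<Phi> \<triangleleft> f' \<bullet> \<epsilon>i) \<triangleleft> f = \<Phi>" .
qed

end


section \<open>The inertia groupoid\<close>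

text \<open>In a locale with both a field and a group, the facts of the library on units refer to the group.\<close>

lemmas (in comm_monoid) scalar_units =
  Units_closed Units_m_closed Units_inv_Units Units_inv_closed
lemmas (in comm_monoid) scalar_units_r_inv = Units_r_inv
lemmas (in comm_monoid) scalar_units_of_inv = units_of_inv

section \<open>Scalar identities\<close>

text \<open>Meant for the composition law, where \<open>b\<close> over \<open>a \<otimes> d\<close>
  is the scalar in question and \<open>a\<close> is the factor that appears on one side of the
  comparison.\<close>

lemma (in comm_monoid) Units_mult_inv_cancel:
  assumes u: "a \<in> Units G" "b \<in> Units G" "d \<in> Units G"
  shows "b \<otimes> inv (a \<otimes> d) \<otimes> a = inv d \<otimes> b"
proof -
  have ad: "a \<otimes> d \<in> Units G" using u by blast
  have "b \<otimes> inv (a \<otimes> d) \<otimes> a = (b \<otimes> inv (a \<otimes> d) \<otimes> a) \<otimes> (d \<otimes> inv d)"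
    using u ad by (simp add: Units_closed)
  also have "\<dots> = (inv d \<otimes> b) \<otimes> ((a \<otimes> d) \<otimes> inv (a \<otimes> d))"
    using u ad by (simp add: m_ac Units_closed del: Units_r_inv Units_l_inv)
  also have "\<dots> = inv d \<otimes> b"
    using u ad by (simp add: Units_closed)
  finally show ?thesis .
qed

text \<open>Cross-multiplication: padding the left side with \<open>r \<otimes> s\<close> over
  itself makes \<open>eq\<close> applicable, and \<open>p \<otimes> q\<close> then cancels.\<close>

lemma (in comm_group) mult_quotients_eq:
  assumes c: "a \<in> carrier G" "b \<in> carrier G" "c \<in> carrier G" "d \<in> carrier G"
    "p \<in> carrier G" "q \<in> carrier G" "r \<in> carrier G" "s \<in> carrier G"
    and eq: "a \<otimes> b \<otimes> (r \<otimes> s) = c \<otimes> d \<otimes> (p \<otimes> q)"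
  shows "(a \<otimes> inv p) \<otimes> (b \<otimes> inv q) = (c \<otimes> inv r) \<otimes> (d \<otimes> inv s)"
proof -
  have rs: "r \<otimes> s \<in> carrier G" and pq: "p \<otimes> q \<in> carrier G" using c by simp_all
  have "(a \<otimes> inv p) \<otimes> (b \<otimes> inv q) = a \<otimes> b \<otimes> inv (p \<otimes> q) \<otimes> ((r \<otimes> s) \<otimes> inv (r \<otimes> s))"
    using c rs by (simp add: inv_mult) (simp add: m_ac)
  also have "\<dots> = a \<otimes> b \<otimes> (r \<otimes> s) \<otimes> inv (p \<otimes> q) \<otimes> inv (r \<otimes> s)"
    using c rs pq by (simp only: m_ac m_closed inv_closed)
  also have "\<dots> = c \<otimes> d \<otimes> inv (r \<otimes> s) \<otimes> ((p \<otimes> q) \<otimes> inv (p \<otimes> q))"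
    unfolding eq using c rs pq by (simp add: m_ac del: r_inv l_inv)
  also have "\<dots> = (c \<otimes> inv r) \<otimes> (d \<otimes> inv s)"
    using c pq by (simp add: inv_mult) (simp add: m_ac)
  finally show ?thesis .
qed

text \<open>With the values of \<open>\<alpha>\<close> inserted, \<open>e1\<close>--\<open>e4\<close> are the four instances of the cocycle identity
  which combine to the 2-cocycle identity of the transgression.\<close>

lemma (in comm_group) transgression_cocycle_aux:
  assumes c: "A1 \<in> carrier G" "A2 \<in> carrier G" "A3 \<in> carrier G" "B1 \<in> carrier G" "B2 \<in> carrier G"
    "B3 \<in> carrier G" "C1 \<in> carrier G" "C2 \<in> carrier G" "C3 \<in> carrier G" "D1 \<in> carrier G"
    "D2 \<in> carrier G" "D3 \<in> carrier G" "U \<in> carrier G" "W \<in> carrier G" "Y \<in> carrier G" "Z \<in> carrier G"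
    and e1: "B1 \<otimes> A1 \<otimes> U = C1 \<otimes> W" and e2: "U \<otimes> C2 \<otimes> D2 = Y \<otimes> A2"
    and e3: "B2 \<otimes> Z \<otimes> D3 = Y \<otimes> A3" and e4: "B3 \<otimes> Z \<otimes> D1 = C3 \<otimes> W"
  shows "(A1 \<otimes> A2 \<otimes> inv A3) \<otimes> (B1 \<otimes> B2 \<otimes> inv B3) = (C1 \<otimes> C2 \<otimes> inv C3) \<otimes> (D1 \<otimes> D2 \<otimes> inv D3)"
proof (rule mult_quotients_eq)
  \<comment> \<open>The values \<open>U\<close>, \<open>W\<close>, \<open>Y\<close>,
    \<open>Z\<close> are absent from the claim. Each lies in two of the four equations; using
    \<open>e2\<close> and \<open>e4\<close> from right to left puts each of them once on either
    side, where it cancels.\<close>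
  have "(U \<otimes> W \<otimes> Y \<otimes> Z) \<otimes> (A1 \<otimes> A2 \<otimes> (B1 \<otimes> B2) \<otimes> (C3 \<otimes> D3))
      = (B1 \<otimes> A1 \<otimes> U) \<otimes> (Y \<otimes> A2) \<otimes> (B2 \<otimes> Z \<otimes> D3) \<otimes> (C3 \<otimes> W)"
    using c by (simp add: m_ac)
  also have "\<dots> = (C1 \<otimes> W) \<otimes> (U \<otimes> C2 \<otimes> D2) \<otimes> (Y \<otimes> A3) \<otimes> (B3 \<otimes> Z \<otimes> D1)"
    by (simp only: e1 e2 e3 e4)
  also have "\<dots> = (U \<otimes> W \<otimes> Y \<otimes> Z) \<otimes> (C1 \<otimes> C2 \<otimes> (D1 \<otimes> D2) \<otimes> (A3 \<otimes> B3))"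
    using c by (simp add: m_ac)
  finally show "A1 \<otimes> A2 \<otimes> (B1 \<otimes> B2) \<otimes> (C3 \<otimes> D3) = C1 \<otimes> C2 \<otimes> (D1 \<otimes> D2) \<otimes> (A3 \<otimes> B3)"
    using c by simp
qed (use c in simp_all)

section \<open>Conjugation\<close>

context group
begin

lemma conjugate_closed [simp]: "\<lbrakk>g \<in> carrier G; h \<in> carrier G\<rbrakk> \<Longrightarrow> conjugate G h g \<in> carrier G"
  by simp

lemma conjugate_mult: "\<lbrakk>g \<in> carrier G; h \<in> carrier G\<rbrakk> \<Longrightarrow> conjugate G h g \<otimes> h = h \<otimes> g"
  by (simp add: m_assoc)

lemma conjugate_conjugate:
  "\<lbrakk>r \<in> carrier G; g \<in> carrier G; h \<in> carrier G\<rbrakk>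
    \<Longrightarrow> conjugate G h (conjugate G g r) = conjugate G (h \<otimes> g) r"
  by (simp add: m_assoc inv_mult_group)

lemma conjugate_one: "g \<in> carrier G \<Longrightarrow> conjugate G \<one> g = g"
  by simp

end

section \<open>The transgression and the central extension\<close>

context normalised_3_cocycle
begin

lemmas G_assoc = monoid.m_assoc[OF group.is_monoid[OF group_axioms]]

lemma alpha_closed [simp]:
  "\<lbrakk>g \<in> carrier G; h \<in> carrier G; k \<in> carrier G\<rbrakk> \<Longrightarrow> \<alpha> g h k \<in> carrier K"
  using unit_valued by (auto simp: Units_def)

lemma transgression_Units:
  "\<lbrakk>g \<in> carrier G; h \<in> carrier G; k \<in> carrier G; s \<in> carrier G; t \<in> carrier G\<rbrakk>
    \<Longrightarrow> transgression K \<alpha> g h k s t \<in> Units K"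
  using unit_valued scalar_units by (simp add: transgression_def)

text \<open>The four instances of the cocycle identity insert the loop into each position of the
  triple (h, g, f); on its way past f, g and h it changes from w to x, y and z. The hypotheses are
  stated as commutation rules because this is how the products inside \<alpha> are
  rewritten.\<close>

lemma transgression_cocycle:
  assumes G: "w \<in> carrier G" "x \<in> carrier G" "y \<in> carrier G" "z \<in> carrier G"
      "f \<in> carrier G" "g \<in> carrier G" "h \<in> carrier G"
    and x: "x \<otimes>\<^bsub>G\<^esub> f = f \<otimes>\<^bsub>G\<^esub> w" and y: "y \<otimes>\<^bsub>G\<^esub> g = g \<otimes>\<^bsub>G\<^esub> x" and z: "z \<otimes>\<^bsub>G\<^esub> h = h \<otimes>\<^bsub>G\<^esub> y"
  shows "transgression K \<alpha> w y z (g \<otimes>\<^bsub>G\<^esub> f) h \<otimes>\<^bsub>K\<^esub> transgression K \<alpha> w x y f g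
    = transgression K \<alpha> w x z f (h \<otimes>\<^bsub>G\<^esub> g) \<otimes>\<^bsub>K\<^esub> transgression K \<alpha> x y z g h"
proof -
  \<comment> \<open>All values of \<alpha> are units, so the computation takes place in a
    commutative group, where cancellation is available. Inverses taken there agree with those of
    \<open>K\<close>.\<close>
  interpret U: comm_group "units_of K"
    by (rule units_comm_group)
  have u: "\<alpha> p q r \<in> carrier (units_of K)" if "p \<in> carrier G" "q \<in> carrier G" "r \<in> carrier G" for p q r
    using unit_valued that by (simp add: units_of_def)
  have i: "inv\<^bsub>K\<^esub> \<alpha> p q r = inv\<^bsub>units_of K\<^esub> \<alpha> p q r" if "p \<in> carrier G" "q \<in> carrier G" "r \<in> carrier G" for p q r
    using scalar_units_of_inv unit_valued that by simp
  show ?thesis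
    using U.transgression_cocycle_aux[of "\<alpha> h (g \<otimes>\<^bsub>G\<^esub> f) w" "\<alpha> z h (g \<otimes>\<^bsub>G\<^esub> f)" "\<alpha> h y (g \<otimes>\<^bsub>G\<^esub> f)"
        "\<alpha> g f w" "\<alpha> y g f" "\<alpha> g x f" "\<alpha> (h \<otimes>\<^bsub>G\<^esub> g) f w" "\<alpha> z (h \<otimes>\<^bsub>G\<^esub> g) f" "\<alpha> (h \<otimes>\<^bsub>G\<^esub> g) x f"
        "\<alpha> h g x" "\<alpha> z h g" "\<alpha> h y g" "\<alpha> h g f" "\<alpha> h g (x \<otimes>\<^bsub>G\<^esub> f)" "\<alpha> (h \<otimes>\<^bsub>G\<^esub> y) g f" "\<alpha> h (g \<otimes>\<^bsub>G\<^esub> x) f"]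
      cocycle[of h g f w] cocycle[of z h g f] cocycle[of h y g f] cocycle[of h g x f]
    using G by (simp add: transgression_def units_of_mult u i x y z)
qed

lemma inertia_homD:
  assumes "s \<in> inertia_hom G g h" "g \<in> carrier G"
  shows "s \<in> carrier G" "conjugate G s g = h" "h \<otimes>\<^bsub>G\<^esub> s = s \<otimes>\<^bsub>G\<^esub> g"
  using assms conjugate_mult by (auto simp: inertia_hom_def)

lemma inertia_hom_mult:
  assumes "s \<in> inertia_hom G g h" "t \<in> inertia_hom G h k" "g \<in> carrier G"
  shows "t \<otimes>\<^bsub>G\<^esub> s \<in> inertia_hom G g k"
  using assms conjugate_conjugate[of g s t] by (auto simp: inertia_hom_def)

text \<open>Associativity rests on the 2-cocycle property of the transgression. The identity laws
  rest on normalisation: if one of the two arrows is the unit of \<open>G\<close>, all three values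
  of \<alpha> in the transgression are 1.\<close>

lemma category_inertia_extension: "category (inertia_extension K G \<alpha>)"
proof
  fix x y z f g
  assume "x \<in> Ob (inertia_extension K G \<alpha>)" "y \<in> Ob (inertia_extension K G \<alpha>)"
    "z \<in> Ob (inertia_extension K G \<alpha>)" "f \<in> Hom (inertia_extension K G \<alpha>) x y"
    "g \<in> Hom (inertia_extension K G \<alpha>) y z"
  then show "Cmp (inertia_extension K G \<alpha>) x y z g f \<in> Hom (inertia_extension K G \<alpha>) x z"
    by (auto simp: inertia_extension_def intro!: scalar_units(2) transgression_Units inertia_hom_mult
        dest: inertia_homD)
next
  fix x
  assume "x \<in> Ob (inertia_extension K G \<alpha>)"
  then show "Idt (inertia_extension K G \<alpha>) x \<in> Hom (inertia_extension K G \<alpha>) x x"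
    using conjugate_one by (simp add: inertia_extension_def inertia_hom_def)
next
  fix w x y z f g h
  assume ob: "w \<in> Ob (inertia_extension K G \<alpha>)" "x \<in> Ob (inertia_extension K G \<alpha>)"
    "y \<in> Ob (inertia_extension K G \<alpha>)" "z \<in> Ob (inertia_extension K G \<alpha>)"
    and hom: "f \<in> Hom (inertia_extension K G \<alpha>) w x" "g \<in> Hom (inertia_extension K G \<alpha>) x y"
    "h \<in> Hom (inertia_extension K G \<alpha>) y z"
  from hom obtain a b c s t u where [simp]: "f = (a, s)" "g = (b, t)" "h = (c, u)"
    and abc: "a \<in> Units K" "b \<in> Units K" "c \<in> Units K"
    and stu: "s \<in> inertia_hom G w x" "t \<in> inertia_hom G x y" "u \<in> inertia_hom G y z"
    by (auto simp: inertia_extension_def)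
  have G: "w \<in> carrier G" "x \<in> carrier G" "y \<in> carrier G" "z \<in> carrier G"
    using ob by (simp_all add: inertia_extension_def)
  note s = inertia_homD[OF stu(1) G(1)] and t = inertia_homD[OF stu(2) G(2)]
    and u = inertia_homD[OF stu(3) G(3)]
  define \<tau>1 where "\<tau>1 = transgression K \<alpha> w y z (t \<otimes>\<^bsub>G\<^esub> s) u"
  define \<tau>2 where "\<tau>2 = transgression K \<alpha> w x y s t"
  define \<tau>3 where "\<tau>3 = transgression K \<alpha> w x z s (u \<otimes>\<^bsub>G\<^esub> t)"
  define \<tau>4 where "\<tau>4 = transgression K \<alpha> x y z t u"
  have K: "\<tau>1 \<in> carrier K" "\<tau>2 \<in> carrier K" "\<tau>3 \<in> carrier K" "\<tau>4 \<in> carrier K"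
    "a \<in> carrier K" "b \<in> carrier K" "c \<in> carrier K"
    using abc G s(1) t(1) u(1)
    by (auto simp: \<tau>1_def \<tau>2_def \<tau>3_def \<tau>4_def intro!: scalar_units(1) transgression_Units)
  \<comment> \<open>The labels a, b, c contribute the same product to either bracketing, so only the
    two products of transgressions need comparing.\<close>
  have "\<tau>1 \<otimes>\<^bsub>K\<^esub> (\<tau>2 \<otimes>\<^bsub>K\<^esub> (a \<otimes>\<^bsub>K\<^esub> b) \<otimes>\<^bsub>K\<^esub> c) = (\<tau>1 \<otimes>\<^bsub>K\<^esub> \<tau>2) \<otimes>\<^bsub>K\<^esub> (a \<otimes>\<^bsub>K\<^esub> b \<otimes>\<^bsub>K\<^esub> c)"
    using K by algebra
  also have "\<tau>1 \<otimes>\<^bsub>K\<^esub> \<tau>2 = \<tau>3 \<otimes>\<^bsub>K\<^esub> \<tau>4"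
    unfolding \<tau>1_def \<tau>2_def \<tau>3_def \<tau>4_def
    by (rule transgression_cocycle) (use G s t u in auto)
  also have "\<tau>3 \<otimes>\<^bsub>K\<^esub> \<tau>4 \<otimes>\<^bsub>K\<^esub> (a \<otimes>\<^bsub>K\<^esub> b \<otimes>\<^bsub>K\<^esub> c) = \<tau>3 \<otimes>\<^bsub>K\<^esub> (a \<otimes>\<^bsub>K\<^esub> (\<tau>4 \<otimes>\<^bsub>K\<^esub> (b \<otimes>\<^bsub>K\<^esub> c)))"
    using K by algebra
  finally show "Cmp (inertia_extension K G \<alpha>) w y z h (Cmp (inertia_extension K G \<alpha>) w x y g f)
      = Cmp (inertia_extension K G \<alpha>) w x z (Cmp (inertia_extension K G \<alpha>) x y z h g) f"
    using s(1) t(1) u(1)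
    by (simp add: inertia_extension_def \<tau>1_def \<tau>2_def \<tau>3_def \<tau>4_def G_assoc)
next
  fix x y f
  assume ob: "x \<in> Ob (inertia_extension K G \<alpha>)" "y \<in> Ob (inertia_extension K G \<alpha>)"
    and hom: "f \<in> Hom (inertia_extension K G \<alpha>) x y"
  from hom obtain a s where f: "f = (a, s)" "a \<in> Units K" "s \<in> inertia_hom G x y"
    by (auto simp: inertia_extension_def)
  have G: "x \<in> carrier G" "y \<in> carrier G"
    using ob by (simp_all add: inertia_extension_def)
  have "transgression K \<alpha> x y y s \<one>\<^bsub>G\<^esub> = \<one>\<^bsub>K\<^esub>" "transgression K \<alpha> x x y \<one>\<^bsub>G\<^esub> s = \<one>\<^bsub>K\<^esub>"
    using G inertia_homD(1)[OF f(3) G(1)] normalised by (simp_all add: transgression_def)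
  then show "Cmp (inertia_extension K G \<alpha>) x y y (Idt (inertia_extension K G \<alpha>) y) f = f"
    "Cmp (inertia_extension K G \<alpha>) x x y f (Idt (inertia_extension K G \<alpha>) x) = f"
    using f(1,2) inertia_homD(1)[OF f(3) G(1)] monoid.l_one[OF group.is_monoid[OF group_axioms]]
      monoid.r_one[OF group.is_monoid[OF group_axioms]]
    by (simp_all add: inertia_extension_def scalar_units)
qed

end


section \<open>The categorical character\<close>

sublocale linear_representation \<subseteq> linear_2_category_at K C V
  by unfold_locales (rule object)

text \<open>Restates the locale with \<open>C\<close> as implicit structure.\<close>

locale character_of_representation = linear_representation K G \<alpha> C V \<rho> \<psi> \<psi>1
  for K :: "('k, 'm) ring_scheme" and G :: "('g, 'n) monoid_scheme"
    and \<alpha> :: "'g \<Rightarrow> 'g \<Rightarrow> 'g \<Rightarrow> 'k" and C :: "('o, 'f, 'k, 'c, 'z) two_cat_scheme" (structure)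
    and V :: 'o and \<rho> :: "'g \<Rightarrow> 'f" and \<psi> :: "'g \<Rightarrow> 'g \<Rightarrow> 'c" and \<psi>1 :: 'c
begin

abbreviation \<beta> :: "'g \<Rightarrow> 'g \<Rightarrow> 'c \<Rightarrow> 'c"
  where "\<beta> \<equiv> char_map G C V \<rho> \<psi> \<psi>1"

lemma rho_closed [simp]: "g \<in> carrier G \<Longrightarrow> \<rho> g \<in> E"
  using rho by (simp add: weakly_invertible_def)

lemma psi_cell: "\<lbrakk>g \<in> carrier G; h \<in> carrier G\<rbrakk> \<Longrightarrow> cell (\<rho> g \<diamondop> \<rho> h) (\<rho> (g \<otimes>\<^bsub>G\<^esub> h)) (\<psi> g h)"
  using psi by (auto simp: cell_def iso2_def)

text \<open>The coherence of \<psi> as the composition law uses it: acting on a further cell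
  \<theta>, with the scalar in front and products bracketed to the right, as
  \<open>comp_assoc\<close> leaves them.\<close>

lemma psi_assoc_vert:
  assumes G: "g \<in> carrier G" "h \<in> carrier G" "k \<in> carrier G"
    and \<theta>: "cell f (\<rho> g \<diamondop> (\<rho> h \<diamondop> \<rho> k)) \<theta>"
  shows "\<psi> g (h \<otimes>\<^bsub>G\<^esub> k) \<bullet> (\<rho> g \<triangleright> \<psi> h k \<bullet> \<theta>)
    = \<alpha> g h k \<odot>\<^bsub>Hom2 C f (\<rho> (g \<otimes>\<^bsub>G\<^esub> (h \<otimes>\<^bsub>G\<^esub> k)))\<^esub>
        (\<psi> (g \<otimes>\<^bsub>G\<^esub> h) k \<bullet> (\<psi> g h \<triangleleft> \<rho> k \<bullet> \<theta>))"
proof -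
  have c1: "cell (\<rho> g \<diamondop> \<rho> (h \<otimes>\<^bsub>G\<^esub> k)) (\<rho> (g \<otimes>\<^bsub>G\<^esub> (h \<otimes>\<^bsub>G\<^esub> k))) (\<psi> g (h \<otimes>\<^bsub>G\<^esub> k))"
    using psi_cell[of g "h \<otimes>\<^bsub>G\<^esub> k"] G by simp
  have c2: "cell (\<rho> g \<diamondop> (\<rho> h \<diamondop> \<rho> k)) (\<rho> g \<diamondop> \<rho> (h \<otimes>\<^bsub>G\<^esub> k)) (\<rho> g \<triangleright> \<psi> h k)"
    using cell_wl[OF _ psi_cell] G by simp
  have c3: "cell (\<rho> (g \<otimes>\<^bsub>G\<^esub> h) \<diamondop> \<rho> k) (\<rho> (g \<otimes>\<^bsub>G\<^esub> (h \<otimes>\<^bsub>G\<^esub> k))) (\<psi> (g \<otimes>\<^bsub>G\<^esub> h) k)"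
    using psi_cell[of "g \<otimes>\<^bsub>G\<^esub> h" k] G by (simp add: G_assoc)
  have c4: "cell (\<rho> g \<diamondop> (\<rho> h \<diamondop> \<rho> k)) (\<rho> (g \<otimes>\<^bsub>G\<^esub> h) \<diamondop> \<rho> k) (\<psi> g h \<triangleleft> \<rho> k)"
    using cell_wr[OF _ psi_cell, of "\<rho> k" g h] G by simp
  have "\<psi> g (h \<otimes>\<^bsub>G\<^esub> k) \<bullet> (\<rho> g \<triangleright> \<psi> h k \<bullet> \<theta>) = \<psi> g (h \<otimes>\<^bsub>G\<^esub> k) \<bullet> \<rho> g \<triangleright> \<psi> h k \<bullet> \<theta>"
    using vassoc[OF c1 c2 \<theta>] by simp
  also have "\<psi> g (h \<otimes>\<^bsub>G\<^esub> k) \<bullet> \<rho> g \<triangleright> \<psi> h k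
      = \<alpha> g h k \<odot>\<^bsub>Hom2 C (\<rho> g \<diamondop> (\<rho> h \<diamondop> \<rho> k)) (\<rho> (g \<otimes>\<^bsub>G\<^esub> (h \<otimes>\<^bsub>G\<^esub> k)))\<^esub>
          (\<psi> (g \<otimes>\<^bsub>G\<^esub> h) k \<bullet> \<psi> g h \<triangleleft> \<rho> k)"
    using psi_assoc[OF G] G by (simp add: G_assoc)
  also have "\<dots> \<bullet> \<theta> = \<alpha> g h k \<odot>\<^bsub>Hom2 C f (\<rho> (g \<otimes>\<^bsub>G\<^esub> (h \<otimes>\<^bsub>G\<^esub> k)))\<^esub>
        (\<psi> (g \<otimes>\<^bsub>G\<^esub> h) k \<bullet> (\<psi> g h \<triangleleft> \<rho> k \<bullet> \<theta>))"
    using vert_smult_left[OF _ cell_vert[OF c3 c4] \<theta>] vassoc[OF c3 c4 \<theta>] G by simp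
  finally show ?thesis .
qed

section \<open>Weak inverses in the image of the representation\<close>

text \<open>This cell closes the composite defining \<beta>, and \<open>counit_inv\<close> opens it.
  With the inverse of the counit at h\<inverse> as unit, it misses being the counit of an adjunction
  only by a scalar.\<close>

definition counit :: "'g \<Rightarrow> 'c"
  where "counit h = \<psi>1 \<bullet> \<psi> h (inv\<^bsub>G\<^esub> h)"

definition counit_inv :: "'g \<Rightarrow> 'c"
  where "counit_inv h = inv2 C (\<rho> h \<diamondop> \<rho> (inv\<^bsub>G\<^esub> h)) (\<rho> \<one>\<^bsub>G\<^esub>) (\<psi> h (inv\<^bsub>G\<^esub> h))
    \<bullet> inv2 C (\<rho> \<one>\<^bsub>G\<^esub>) I \<psi>1"

lemma counit:
  assumes h: "h \<in> carrier G"
  shows "cell (\<rho> h \<diamondop> \<rho> (inv\<^bsub>G\<^esub> h)) I (counit h)" "cell I (\<rho> h \<diamondop> \<rho> (inv\<^bsub>G\<^esub> h)) (counit_inv h)"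
    "counit_inv h \<bullet> counit h = Id2 C (\<rho> h \<diamondop> \<rho> (inv\<^bsub>G\<^esub> h))" "counit h \<bullet> counit_inv h = Id2 C I"
proof -
  have "iso2 C (\<rho> h \<diamondop> \<rho> (inv\<^bsub>G\<^esub> h)) (\<rho> \<one>\<^bsub>G\<^esub>) (\<psi> h (inv\<^bsub>G\<^esub> h))"
    using psi[of h "inv\<^bsub>G\<^esub> h"] h by simp
  note p = inv2[OF _ _ this] and q = inv2[OF _ _ psi1]
  show c: "cell (\<rho> h \<diamondop> \<rho> (inv\<^bsub>G\<^esub> h)) I (counit h)"
    "cell I (\<rho> h \<diamondop> \<rho> (inv\<^bsub>G\<^esub> h)) (counit_inv h)"
    using cell_vert[OF q(1) p(1)] cell_vert[OF p(2) q(2)] h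
    by (simp_all add: counit_def counit_inv_def)
  show "counit_inv h \<bullet> counit h = Id2 C (\<rho> h \<diamondop> \<rho> (inv\<^bsub>G\<^esub> h))"
    using vassoc[OF p(2) q(2) c(1)] vassoc[OF q(2) q(1) p(1)] q(3) p(3) vert_Id2(1)[OF p(1)] h
    by (simp add: counit_def counit_inv_def)
  show "counit h \<bullet> counit_inv h = Id2 C I"
    using vassoc[OF q(1) p(1) c(2)] vassoc[OF p(1) p(2) q(2)] q(4) p(4) vert_Id2(1)[OF q(2)] h
    by (simp add: counit_def counit_inv_def)
qed

text \<open>This is the associativity of \<psi> at (h, h\<inverse>, h), where the unit conditions
  turn the outer \<psi> into whiskered copies of \<open>\<psi>1\<close>. The value of \<alpha> at
  this triple can differ from 1 even for a normalised cocycle.\<close>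

lemma counit_zigzag:
  assumes h: "h \<in> carrier G"
  shows "counit h \<triangleleft> \<rho> h
    = inv\<^bsub>K\<^esub> (\<alpha> h (inv\<^bsub>G\<^esub> h) h) \<odot>\<^bsub>Hom2 C (\<rho> h \<diamondop> (\<rho> (inv\<^bsub>G\<^esub> h) \<diamondop> \<rho> h)) (\<rho> h)\<^esub>
        (\<rho> h \<triangleright> counit (inv\<^bsub>G\<^esub> h))"
proof -
  let ?h' = "inv\<^bsub>G\<^esub> h" and ?M = "Hom2 C (\<rho> h \<diamondop> (\<rho> (inv\<^bsub>G\<^esub> h) \<diamondop> \<rho> h)) (\<rho> h)"
  interpret M: module K ?M
    using module_Hom2 h by simp
  have u: "\<alpha> h ?h' h \<in> Units K"
    using unit_valued h by simp
  have p: "cell (\<rho> h \<diamondop> \<rho> ?h') (\<rho> \<one>\<^bsub>G\<^esub>) (\<psi> h ?h')" "cell (\<rho> ?h' \<diamondop> \<rho> h) (\<rho> \<one>\<^bsub>G\<^esub>) (\<psi> ?h' h)"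
    using psi_cell[of h ?h'] psi_cell[of ?h' h] h by simp_all
  have q: "cell (\<rho> \<one>\<^bsub>G\<^esub>) I \<psi>1"
    using inv2(1)[OF _ _ psi1] by simp
  have l: "counit h \<triangleleft> \<rho> h = \<psi> \<one>\<^bsub>G\<^esub> h \<bullet> \<psi> h ?h' \<triangleleft> \<rho> h"
    using wr_vert[OF _ q p(1)] psi_unit_left h by (simp add: counit_def)
  have r: "\<rho> h \<triangleright> counit ?h' = \<psi> h \<one>\<^bsub>G\<^esub> \<bullet> \<rho> h \<triangleright> \<psi> ?h' h"
    using wl_vert[OF _ q p(2)] psi_unit_right h by (simp add: counit_def)
  have "\<rho> h \<triangleright> counit ?h' = \<alpha> h ?h' h \<odot>\<^bsub>?M\<^esub> (counit h \<triangleleft> \<rho> h)"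
    using psi_assoc[of h ?h' h] h by (simp add: l r)
  moreover have "counit h \<triangleleft> \<rho> h \<in> carrier ?M"
    using cell_wr[OF _ counit(1)[OF h], of "\<rho> h"] h by (simp add: cell_def)
  ultimately show ?thesis
    using u h by (simp add: M.smult_assoc1[symmetric])
qed

section \<open>The equation that characterises \<open>\<beta>\<close>\<close>

lemma beta_eq:
  "\<beta> g h \<eta> = \<rho> (conjugate G h g) \<triangleright> counit h
    \<bullet> inv2 C (\<rho> (conjugate G h g) \<diamondop> \<rho> h) (\<rho> (h \<otimes>\<^bsub>G\<^esub> g)) (\<psi> (conjugate G h g) h) \<triangleleft> \<rho> (inv\<^bsub>G\<^esub> h)
    \<bullet> \<psi> h g \<triangleleft> \<rho> (inv\<^bsub>G\<^esub> h) \<bullet> (\<rho> h \<triangleright> \<eta>) \<triangleleft> \<rho> (inv\<^bsub>G\<^esub> h) \<bullet> counit_inv h"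
  by (simp add: char_map_def counit_def counit_inv_def Let_def)

lemma psi_conjugate:
  assumes "g \<in> carrier G" "h \<in> carrier G"
  shows "iso2 C (\<rho> (conjugate G h g) \<diamondop> \<rho> h) (\<rho> (h \<otimes>\<^bsub>G\<^esub> g)) (\<psi> (conjugate G h g) h)"
  using psi[of "conjugate G h g" h] assms by (simp only: conjugate_mult conjugate_closed)

text \<open>The composite has the shape treated in \<open>zigzag\<close>, with \<Phi> made of the
  three middle arrows before they are whiskered by \<rho>(h\<inverse>). So whiskering it by
  \<rho>(h) gives back \<Phi>, and composing with \<psi> removes the inverse contained in
  \<Phi>.\<close>

lemma beta:
  assumes g: "g \<in> carrier G" and h: "h \<in> carrier G" and \<eta>: "cell I (\<rho> g) \<eta>"
  shows "cell I (\<rho> (conjugate G h g)) (\<beta> g h \<eta>)"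
    "\<psi> (conjugate G h g) h \<bullet> \<beta> g h \<eta> \<triangleleft> \<rho> h = \<psi> h g \<bullet> \<rho> h \<triangleright> \<eta>"
proof -
  define c where "c = conjugate G h g"
  let ?h' = "inv\<^bsub>G\<^esub> h"
  have c: "c \<in> carrier G" using g h by (simp add: c_def)
  define p where "p = inv2 C (\<rho> c \<diamondop> \<rho> h) (\<rho> (h \<otimes>\<^bsub>G\<^esub> g)) (\<psi> c h)"
  define \<Phi> where "\<Phi> = p \<bullet> \<psi> h g \<bullet> \<rho> h \<triangleright> \<eta>"
  have iso: "iso2 C (\<rho> c \<diamondop> \<rho> h) (\<rho> (h \<otimes>\<^bsub>G\<^esub> g)) (\<psi> c h)"
    using psi_conjugate[OF g h] by (simp add: c_def)
  have h': "\<rho> ?h' \<in> E" using h by simp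
  have p: "cell (\<rho> c \<diamondop> \<rho> h) (\<rho> (h \<otimes>\<^bsub>G\<^esub> g)) (\<psi> c h)" "cell (\<rho> (h \<otimes>\<^bsub>G\<^esub> g)) (\<rho> c \<diamondop> \<rho> h) p"
    "\<psi> c h \<bullet> p = Id2 C (\<rho> (h \<otimes>\<^bsub>G\<^esub> g))"
    using inv2[OF _ _ iso] c h g by (simp_all add: p_def)
  have q: "cell (\<rho> h \<diamondop> \<rho> g) (\<rho> (h \<otimes>\<^bsub>G\<^esub> g)) (\<psi> h g)"
    using psi_cell h g by simp
  have n: "cell (\<rho> h) (\<rho> h \<diamondop> \<rho> g) (\<rho> h \<triangleright> \<eta>)"
    using cell_wl[OF _ \<eta>, of "\<rho> h"] h by simp
  have pq: "cell (\<rho> h \<diamondop> \<rho> g) (\<rho> c \<diamondop> \<rho> h) (p \<bullet> \<psi> h g)"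
    using cell_vert[OF p(2) q] .
  have F: "cell (\<rho> h) (\<rho> c \<diamondop> \<rho> h) \<Phi>"
    unfolding \<Phi>_def using cell_vert[OF pq n] .
  have cc: "cell (\<rho> c \<diamondop> (\<rho> h \<diamondop> \<rho> ?h')) (\<rho> c) (\<rho> c \<triangleright> counit h)"
    using cell_wl[OF _ counit(1)[OF h], of "\<rho> c"] c h by simp
  have w: "cell (\<rho> (h \<otimes>\<^bsub>G\<^esub> g) \<diamondop> \<rho> ?h') (\<rho> c \<diamondop> (\<rho> h \<diamondop> \<rho> ?h')) (p \<triangleleft> \<rho> ?h')"
    "cell (\<rho> h \<diamondop> \<rho> g \<diamondop> \<rho> ?h') (\<rho> (h \<otimes>\<^bsub>G\<^esub> g) \<diamondop> \<rho> ?h') (\<psi> h g \<triangleleft> \<rho> ?h')"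
    "cell (\<rho> h \<diamondop> \<rho> ?h') (\<rho> h \<diamondop> \<rho> g \<diamondop> \<rho> ?h') ((\<rho> h \<triangleright> \<eta>) \<triangleleft> \<rho> ?h')"
    using cell_wr[OF h' p(2)] cell_wr[OF h' q] cell_wr[OF h' n] c h g by simp_all
  have b: "\<beta> g h \<eta> = \<rho> c \<triangleright> counit h \<bullet> \<Phi> \<triangleleft> \<rho> ?h' \<bullet> counit_inv h"
  proof -
    have "\<beta> g h \<eta> = \<rho> c \<triangleright> counit h \<bullet> p \<triangleleft> \<rho> ?h' \<bullet> \<psi> h g \<triangleleft> \<rho> ?h' \<bullet> (\<rho> h \<triangleright> \<eta>) \<triangleleft> \<rho> ?h' \<bullet> counit_inv h"
      by (simp only: beta_eq p_def c_def)
    then show ?thesis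
      by (simp only: \<Phi>_def wr_vert[OF h' pq n] wr_vert[OF h' p(2) q] vassoc[OF cc w(1,2)]
          vassoc[OF cc cell_vert[OF w(1,2)] w(3)])
  qed
  have z: "cell (\<rho> ?h' \<diamondop> \<rho> h) I (counit ?h')" "inv\<^bsub>K\<^esub> (\<alpha> h ?h' h) \<in> carrier K"
    using counit(1)[of ?h'] unit_valued[of h ?h' h] h by simp_all
  note zz = zigzag[OF _ h' _ F counit[OF h] z counit_zigzag[OF h]]
  show "cell I (\<rho> (conjugate G h g)) (\<beta> g h \<eta>)"
    using zz(1) b c h by (simp add: c_def)
  have "\<beta> g h \<eta> \<triangleleft> \<rho> h = \<Phi>"
    using zz(2) b c h by simp
  then have "\<psi> c h \<bullet> \<beta> g h \<eta> \<triangleleft> \<rho> h = \<psi> h g \<bullet> \<rho> h \<triangleright> \<eta>"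
    using vassoc[OF p(1,2) q] vassoc[OF p(1) pq n] p(3) vert_Id2(1)[OF q] by (simp add: \<Phi>_def)
  then show "\<psi> (conjugate G h g) h \<bullet> \<beta> g h \<eta> \<triangleleft> \<rho> h = \<psi> h g \<bullet> \<rho> h \<triangleright> \<eta>"
    by (simp only: c_def)
qed

text \<open>\<psi> can be cancelled because it is invertible, and \<rho>(h) because whiskering by it
  is faithful. Later identities for \<beta> only have to exhibit a solution, without opening the
  composite again.\<close>

lemma beta_unique:
  assumes g: "g \<in> carrier G" and h: "h \<in> carrier G" and \<eta>: "cell I (\<rho> g) \<eta>"
    and \<xi>: "cell I (\<rho> (conjugate G h g)) \<xi>"
    and eq: "\<psi> (conjugate G h g) h \<bullet> \<xi> \<triangleleft> \<rho> h = \<psi> h g \<bullet> \<rho> h \<triangleright> \<eta>"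
  shows "\<beta> g h \<eta> = \<xi>"
proof -
  note b = beta[OF g h \<eta>]
  have rh: "\<rho> h \<in> E" "\<rho> (inv\<^bsub>G\<^esub> h) \<in> E" using h by simp_all
  have w: "cell (\<rho> h) (\<rho> (conjugate G h g) \<diamondop> \<rho> h) (\<zeta> \<triangleleft> \<rho> h)"
    if "cell I (\<rho> (conjugate G h g)) \<zeta>" for \<zeta>
    using cell_wr[OF rh(1) that] rh by simp
  have "\<beta> g h \<eta> \<triangleleft> \<rho> h = \<xi> \<triangleleft> \<rho> h"
    using iso2_cancel_left[OF _ _ psi_conjugate[OF g h] w[OF b(1)] w[OF \<xi>]] b(2) eq g h by simp
  then show ?thesis
    using wr_faithful[OF rh counit(1,2,4)[OF h] b(1) \<xi>] by simp
qed

section \<open>Unit law and composition law\<close>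

text \<open>By the unit conditions and the exchange law, both sides of the equation for \<eta>
  itself equal \<open>\<eta> \<bullet> \<psi>1\<close>.\<close>

lemma beta_one:
  assumes g: "g \<in> carrier G" and \<eta>: "cell I (\<rho> g) \<eta>"
  shows "\<beta> g \<one>\<^bsub>G\<^esub> \<eta> = \<eta>"
proof (rule beta_unique[OF g _ \<eta>])
  have "cell (\<rho> \<one>\<^bsub>G\<^esub>) I \<psi>1"
    using inv2(1)[OF _ _ psi1] by simp
  then have "\<psi> g \<one>\<^bsub>G\<^esub> \<bullet> \<eta> \<triangleleft> \<rho> \<one>\<^bsub>G\<^esub> = \<psi> \<one>\<^bsub>G\<^esub> g \<bullet> \<rho> \<one>\<^bsub>G\<^esub> \<triangleright> \<eta>"
    using whisker_exchange[of "\<rho> \<one>\<^bsub>G\<^esub>" I \<psi>1 I "\<rho> g" \<eta>] whisker_exchange[of I "\<rho> g" \<eta> "\<rho> \<one>\<^bsub>G\<^esub>" I \<psi>1]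
      psi_unit_left[OF g] psi_unit_right[OF g] wl_I[OF \<eta>] wr_I[OF \<eta>] \<eta> wl_I wr_I by metis
  then show "\<psi> (conjugate G \<one>\<^bsub>G\<^esub> g) \<one>\<^bsub>G\<^esub> \<bullet> \<eta> \<triangleleft> \<rho> \<one>\<^bsub>G\<^esub> = \<psi> \<one>\<^bsub>G\<^esub> g \<bullet> \<rho> \<one>\<^bsub>G\<^esub> \<triangleright> \<eta>"
    by (simp only: conjugate_one[OF g])
qed (use g \<eta> in simp_all)

text \<open>By uniqueness it is enough that the multiple of the iterated \<beta> solves the equation
  for hg. Associativity of \<psi> enters at (r'', h, g), (h, r', g) and (h, g, r), the loop moving
  through all positions. The middle instance is read backwards, so its value stands in the numerator
  and the other two in the denominator.\<close>

lemma beta_comp: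
  assumes r: "r \<in> carrier G" and g: "g \<in> carrier G" and h: "h \<in> carrier G" and \<eta>: "cell I (\<rho> r) \<eta>"
  shows "(\<alpha> h (conjugate G g r) g
      \<otimes>\<^bsub>K\<^esub> inv\<^bsub>K\<^esub> (\<alpha> (conjugate G h (conjugate G g r)) h g \<otimes>\<^bsub>K\<^esub> \<alpha> h g r))
    \<odot>\<^bsub>Hom2 C I (\<rho> (conjugate G h (conjugate G g r)))\<^esub> \<beta> (conjugate G g r) h (\<beta> r g \<eta>)
    = \<beta> r (h \<otimes>\<^bsub>G\<^esub> g) \<eta>"
proof -
  define r' where "r' = conjugate G g r"
  define r'' where "r'' = conjugate G h r'"
  define \<zeta> where "\<zeta> = \<beta> r g \<eta>"
  define \<xi> where "\<xi> = \<beta> r' h \<zeta>"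
  let ?k = "h \<otimes>\<^bsub>G\<^esub> g"
  let ?A = "\<alpha> r'' h g" and ?B = "\<alpha> h r' g" and ?D = "\<alpha> h g r"
  define s where "s = ?B \<otimes>\<^bsub>K\<^esub> inv\<^bsub>K\<^esub> (?A \<otimes>\<^bsub>K\<^esub> ?D)"
  let ?M = "Hom2 C (\<rho> h \<diamondop> \<rho> g) (\<rho> (h \<otimes>\<^bsub>G\<^esub> (g \<otimes>\<^bsub>G\<^esub> r)))"
  have r': "r' \<in> carrier G" unfolding r'_def using r g by simp
  have r'': "r'' \<in> carrier G" unfolding r''_def using r' h by simp
  have k: "?k \<in> carrier G" using h g by simp
  have conj: "conjugate G ?k r = r''"
    unfolding r''_def r'_def using conjugate_conjugate r g h by simp
  have rg: "r' \<otimes>\<^bsub>G\<^esub> g = g \<otimes>\<^bsub>G\<^esub> r" "r'' \<otimes>\<^bsub>G\<^esub> h = h \<otimes>\<^bsub>G\<^esub> r'" "r'' \<otimes>\<^bsub>G\<^esub> ?k = h \<otimes>\<^bsub>G\<^esub> (g \<otimes>\<^bsub>G\<^esub> r)"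
    "h \<otimes>\<^bsub>G\<^esub> r' \<otimes>\<^bsub>G\<^esub> g = h \<otimes>\<^bsub>G\<^esub> (g \<otimes>\<^bsub>G\<^esub> r)"
  proof -
    show a: "r' \<otimes>\<^bsub>G\<^esub> g = g \<otimes>\<^bsub>G\<^esub> r" unfolding r'_def using conjugate_mult r g by simp
    show b: "r'' \<otimes>\<^bsub>G\<^esub> h = h \<otimes>\<^bsub>G\<^esub> r'" unfolding r''_def using conjugate_mult r' h by simp
    show c: "h \<otimes>\<^bsub>G\<^esub> r' \<otimes>\<^bsub>G\<^esub> g = h \<otimes>\<^bsub>G\<^esub> (g \<otimes>\<^bsub>G\<^esub> r)" using a r' h g by (simp add: G_assoc)
    show "r'' \<otimes>\<^bsub>G\<^esub> ?k = h \<otimes>\<^bsub>G\<^esub> (g \<otimes>\<^bsub>G\<^esub> r)"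
      using b c G_assoc[OF r'' h g] by simp
  qed
  interpret M: module K ?M
    using module_Hom2 r h g by simp
  have u: "?A \<in> Units K" "?B \<in> Units K" "?D \<in> Units K"
    using unit_valued r r' r'' g h by auto
  have s: "s \<in> carrier K" unfolding s_def using u scalar_units by simp
  note z = beta[OF r g \<eta>, folded r'_def \<zeta>_def]
  note x = beta[OF r' h z(1), folded r''_def \<xi>_def]
  have E: "\<rho> r \<in> E" "\<rho> g \<in> E" "\<rho> h \<in> E" "\<rho> r' \<in> E" "\<rho> r'' \<in> E" "\<rho> ?k \<in> E" "\<rho> h \<diamondop> \<rho> g \<in> E"
    using r g h r' r'' k by simp_all
  note hg = psi_cell[OF h g]

  \<comment> \<open>\<open>L\<close> and \<open>R\<close> are the two sides of the equation for hg
    with \<xi> as candidate, and \<open>Q\<close> is the cell where the equations for h and g meet.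
    Precomposing with \<psi>(h,g) moves \<open>L\<close> and \<open>R\<close> to \<rho>(h)\<rho>(g),
    where \<open>Q\<close> starts.\<close>
  define L where "L = \<psi> r'' ?k \<bullet> \<xi> \<triangleleft> \<rho> ?k"
  define R where "R = \<psi> ?k r \<bullet> \<rho> ?k \<triangleright> \<eta>"
  define Q where "Q = \<psi> (h \<otimes>\<^bsub>G\<^esub> r') g \<bullet> (\<psi> h r' \<bullet> \<rho> h \<triangleright> \<zeta>) \<triangleleft> \<rho> g"
  have xk: "cell (\<rho> ?k) (\<rho> r'' \<diamondop> \<rho> ?k) (\<xi> \<triangleleft> \<rho> ?k)"
    using cell_wr[OF E(6) x(1)] E by simp
  have p1: "cell (\<rho> r'' \<diamondop> \<rho> ?k) (\<rho> (h \<otimes>\<^bsub>G\<^esub> (g \<otimes>\<^bsub>G\<^esub> r))) (\<psi> r'' ?k)"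
    using psi_cell[OF r'' k] rg by simp
  have cL: "cell (\<rho> ?k) (\<rho> (h \<otimes>\<^bsub>G\<^esub> (g \<otimes>\<^bsub>G\<^esub> r))) L"
    unfolding L_def using cell_vert[OF p1 xk] .
  have nk: "cell (\<rho> ?k) (\<rho> ?k \<diamondop> \<rho> r) (\<rho> ?k \<triangleright> \<eta>)"
    using cell_wl[OF E(6) \<eta>] E by simp
  have p2: "cell (\<rho> ?k \<diamondop> \<rho> r) (\<rho> (h \<otimes>\<^bsub>G\<^esub> (g \<otimes>\<^bsub>G\<^esub> r))) (\<psi> ?k r)"
    using psi_cell[OF k r] r g h by (simp add: G_assoc)
  have cR: "cell (\<rho> ?k) (\<rho> (h \<otimes>\<^bsub>G\<^esub> (g \<otimes>\<^bsub>G\<^esub> r))) R"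
    unfolding R_def using cell_vert[OF p2 nk] .
  have xhg: "cell (\<rho> h \<diamondop> \<rho> g) (\<rho> r'' \<diamondop> (\<rho> h \<diamondop> \<rho> g)) (\<xi> \<triangleleft> (\<rho> h \<diamondop> \<rho> g))"
    using cell_wr[OF E(7) x(1)] E by simp
  have xh: "cell (\<rho> h) (\<rho> r'' \<diamondop> \<rho> h) (\<xi> \<triangleleft> \<rho> h)"
    using cell_wr[OF E(3) x(1)] E by simp
  have hz: "cell (\<rho> h) (\<rho> h \<diamondop> \<rho> r') (\<rho> h \<triangleright> \<zeta>)"
    using cell_wl[OF E(3) z(1)] E by simp
  have zg: "cell (\<rho> g) (\<rho> r' \<diamondop> \<rho> g) (\<zeta> \<triangleleft> \<rho> g)"
    using cell_wr[OF E(2) z(1)] E by simp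
  have ng: "cell (\<rho> g) (\<rho> g \<diamondop> \<rho> r) (\<rho> g \<triangleright> \<eta>)"
    using cell_wl[OF E(2) \<eta>] E by simp
  have hzg: "cell (\<rho> h \<diamondop> \<rho> g) (\<rho> h \<diamondop> (\<rho> r' \<diamondop> \<rho> g)) (\<rho> h \<triangleright> (\<zeta> \<triangleleft> \<rho> g))"
    using cell_wl[OF E(3) zg] .
  have hgn: "cell (\<rho> h \<diamondop> \<rho> g) (\<rho> h \<diamondop> (\<rho> g \<diamondop> \<rho> r)) (\<rho> h \<triangleright> (\<rho> g \<triangleright> \<eta>))"
    using cell_wl[OF E(3) ng] .
  have cQ: "cell (\<rho> h \<diamondop> \<rho> g) (\<rho> (h \<otimes>\<^bsub>G\<^esub> (g \<otimes>\<^bsub>G\<^esub> r))) Q"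
    unfolding Q_def
    using cell_vert[OF _ cell_wr[OF E(2) cell_vert[OF psi_cell[OF h r'] hz]]]
      psi_cell[of "h \<otimes>\<^bsub>G\<^esub> r'" g] h r' g rg by simp

  \<comment> \<open>\<psi>(h,g) slides past \<xi>, so that \<xi> is whiskered by \<rho>(h) and
    \<rho>(g) in turn. Associativity contributes \<open>?A\<close> and exposes the equation for
    \<xi>.\<close>
  have "L \<bullet> \<psi> h g = \<psi> r'' ?k \<bullet> (\<rho> r'' \<triangleright> \<psi> h g \<bullet> \<xi> \<triangleleft> (\<rho> h \<diamondop> \<rho> g))"
    unfolding L_def using vassoc[OF p1 xk hg] whisker_exchange[OF hg x(1)] wl_I[OF hg] by simp
  also have "\<dots> = ?A \<odot>\<^bsub>?M\<^esub> (\<psi> (r'' \<otimes>\<^bsub>G\<^esub> h) g \<bullet> (\<psi> r'' h \<triangleleft> \<rho> g \<bullet> \<xi> \<triangleleft> (\<rho> h \<diamondop> \<rho> g)))"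
    using psi_assoc_vert[OF r'' h g xhg] rg by simp
  also have "\<psi> r'' h \<triangleleft> \<rho> g \<bullet> \<xi> \<triangleleft> (\<rho> h \<diamondop> \<rho> g) = (\<psi> h r' \<bullet> \<rho> h \<triangleright> \<zeta>) \<triangleleft> \<rho> g"
    using wr_wr[OF E(3,2) x(1)] wr_vert[OF E(2) psi_cell[OF r'' h] xh] x(2) by simp
  finally have t1: "L \<bullet> \<psi> h g = ?A \<odot>\<^bsub>?M\<^esub> Q"
    unfolding Q_def using rg by simp

  \<comment> \<open>The scalar \<open>?B\<close> is put in front so that associativity at (h, r', g)
    can absorb it. This exposes the equation for \<zeta>, after which associativity at (h, g, r)
    produces \<open>?D\<close>.\<close>
  have "?B \<odot>\<^bsub>?M\<^esub> Q = ?B \<odot>\<^bsub>?M\<^esub> (\<psi> (h \<otimes>\<^bsub>G\<^esub> r') g \<bullet> (\<psi> h r' \<triangleleft> \<rho> g \<bullet> \<rho> h \<triangleright> (\<zeta> \<triangleleft> \<rho> g)))"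
    unfolding Q_def using wr_vert[OF E(2) psi_cell[OF h r'] hz] wl_wr[OF E(3,2) z(1)] by simp
  also have "\<dots> = \<psi> h (g \<otimes>\<^bsub>G\<^esub> r) \<bullet> (\<rho> h \<triangleright> \<psi> r' g \<bullet> \<rho> h \<triangleright> (\<zeta> \<triangleleft> \<rho> g))"
    using psi_assoc_vert[OF h r' g hzg] rg by simp
  also have "\<rho> h \<triangleright> \<psi> r' g \<bullet> \<rho> h \<triangleright> (\<zeta> \<triangleleft> \<rho> g) = \<rho> h \<triangleright> (\<psi> g r \<bullet> \<rho> g \<triangleright> \<eta>)"
    using wl_vert[OF E(3) psi_cell[OF r' g] zg] z(2) by simp
  also have "\<dots> = \<rho> h \<triangleright> \<psi> g r \<bullet> \<rho> h \<triangleright> (\<rho> g \<triangleright> \<eta>)"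
    using wl_vert[OF E(3) psi_cell[OF g r] ng] .
  also have "\<psi> h (g \<otimes>\<^bsub>G\<^esub> r) \<bullet> \<dots> = ?D \<odot>\<^bsub>?M\<^esub> (\<psi> ?k r \<bullet> (\<psi> h g \<triangleleft> \<rho> r \<bullet> \<rho> h \<triangleright> (\<rho> g \<triangleright> \<eta>)))"
    using psi_assoc_vert[OF h g r hgn] .
  also have "\<psi> h g \<triangleleft> \<rho> r \<bullet> \<rho> h \<triangleright> (\<rho> g \<triangleright> \<eta>) = \<rho> ?k \<triangleright> \<eta> \<bullet> \<psi> h g"
    using whisker_exchange[OF \<eta> hg] wl_wl[OF E(3,2) \<eta>] wr_I[OF hg] by simp
  also have "\<psi> ?k r \<bullet> \<dots> = R \<bullet> \<psi> h g"
    unfolding R_def using vassoc[OF p2 nk hg] by simp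
  finally have t2: "?B \<odot>\<^bsub>?M\<^esub> Q = ?D \<odot>\<^bsub>?M\<^esub> (R \<bullet> \<psi> h g)" .

  have K: "?A \<in> carrier K" "?B \<in> carrier K" "?D \<in> carrier K" "inv\<^bsub>K\<^esub> ?D \<in> carrier K"
    using u by (simp_all add: scalar_units)
  have "(s \<odot>\<^bsub>Hom2 C (\<rho> ?k) (\<rho> (h \<otimes>\<^bsub>G\<^esub> (g \<otimes>\<^bsub>G\<^esub> r)))\<^esub> L) \<bullet> \<psi> h g = s \<odot>\<^bsub>?M\<^esub> (?A \<odot>\<^bsub>?M\<^esub> Q)"
    using vert_smult_left[OF s cL hg] t1 by simp
  also have "\<dots> = (s \<otimes>\<^bsub>K\<^esub> ?A) \<odot>\<^bsub>?M\<^esub> Q"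
    using M.smult_assoc1[OF s K(1) cellD(3)[OF cQ]] by simp
  also have "s \<otimes>\<^bsub>K\<^esub> ?A = inv\<^bsub>K\<^esub> ?D \<otimes>\<^bsub>K\<^esub> ?B"
    unfolding s_def using Units_mult_inv_cancel[OF u] .
  also have "\<dots> \<odot>\<^bsub>?M\<^esub> Q = inv\<^bsub>K\<^esub> ?D \<odot>\<^bsub>?M\<^esub> (?D \<odot>\<^bsub>?M\<^esub> (R \<bullet> \<psi> h g))"
    using M.smult_assoc1[OF K(4,2) cellD(3)[OF cQ]] t2 by simp
  also have "\<dots> = R \<bullet> \<psi> h g"
    using M.smult_assoc1[OF K(4,3) cellD(3)[OF cell_vert[OF cR hg]]]
      cellD(3)[OF cell_vert[OF cR hg]] u by simp
  \<comment> \<open>\<psi>(h,g) is invertible, so the comparison descends from \<rho>(h)\<rho>(g) to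
    \<rho>(hg).\<close>
  finally have "s \<odot>\<^bsub>Hom2 C (\<rho> ?k) (\<rho> (h \<otimes>\<^bsub>G\<^esub> (g \<otimes>\<^bsub>G\<^esub> r)))\<^esub> L = R"
    using iso2_cancel_right[OF _ _ psi[OF h g] cell_smult[OF s cL] cR] E by simp
  then have "\<psi> r'' ?k \<bullet> (s \<odot>\<^bsub>Hom2 C I (\<rho> r'')\<^esub> \<xi>) \<triangleleft> \<rho> ?k = \<psi> ?k r \<bullet> \<rho> ?k \<triangleright> \<eta>"
    using wr_smult[OF s E(6) x(1)] vert_smult_right[OF s p1 xk] E by (simp add: L_def R_def)
  then have "\<beta> r ?k \<eta> = s \<odot>\<^bsub>Hom2 C I (\<rho> r'')\<^esub> \<xi>"
    using beta_unique[OF r k \<eta>] cell_smult[OF s x(1)] unfolding conj by blast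
  then show ?thesis
    unfolding s_def \<xi>_def \<zeta>_def r''_def r'_def by simp
qed


section \<open>The character as a representation of the inertia groupoid\<close>

abbreviation X :: "'g \<Rightarrow> ('k, 'c) module"
  where "X \<equiv> char_space C V \<rho>"

lemma char_space_cell: "g \<in> carrier G \<Longrightarrow> \<eta> \<in> carrier (X g) \<longleftrightarrow> cell I (\<rho> g) \<eta>"
  by (simp add: char_space_def cell_def)

lemma module_char_space: "g \<in> carrier G \<Longrightarrow> module K (X g)"
  by (simp add: char_space_def module_Hom2)

text \<open>\<open>\<beta>\<close> solves an equation which is linear on both sides, and the solution is unique.\<close>

lemma linear_map_beta:
  assumes g: "g \<in> carrier G" and h: "h \<in> carrier G"
  shows "linear_map K (X g) (X (conjugate G h g)) (\<beta> g h)"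
proof -
  define c where "c = conjugate G h g"
  have c: "c \<in> carrier G" using g h by (simp add: c_def)
  interpret Xg: module K "X g" using module_char_space[OF g] .
  interpret Xc: module K "X c" using module_char_space[OF c] .
  let ?M = "Hom2 C (\<rho> h) (\<rho> (h \<otimes>\<^bsub>G\<^esub> g))"
  have p: "cell (\<rho> c \<diamondop> \<rho> h) (\<rho> (h \<otimes>\<^bsub>G\<^esub> g)) (\<psi> c h)"
    using inv2(1)[OF _ _ psi_conjugate[OF g h]] g h c by (simp add: c_def)
  have l: "linear_map K (X c) ?M (\<lambda>\<xi>. \<psi> c h \<bullet> \<xi> \<triangleleft> \<rho> h)"
    using linear_map_comp[OF linear_wr[of "\<rho> h" I "\<rho> c"] linear_vert_left[OF p]] c h
    by (simp add: char_space_def)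
  have r: "linear_map K (X g) ?M (\<lambda>\<eta>. \<psi> h g \<bullet> \<rho> h \<triangleright> \<eta>)"
    using linear_map_comp[OF linear_wl[of "\<rho> h" I "\<rho> g"] linear_vert_left[OF psi_cell[OF h g]]] g h
    by (simp add: char_space_def)
  have b: "\<beta> g h \<eta> \<in> carrier (X c)" "\<psi> c h \<bullet> \<beta> g h \<eta> \<triangleleft> \<rho> h = \<psi> h g \<bullet> \<rho> h \<triangleright> \<eta>"
    if "\<eta> \<in> carrier (X g)" for \<eta>
    using beta[OF g h, folded c_def] that g c by (simp_all add: char_space_cell)
  have u: "\<beta> g h \<eta> = \<xi>" if "\<eta> \<in> carrier (X g)" "\<xi> \<in> carrier (X c)"
    "\<psi> c h \<bullet> \<xi> \<triangleleft> \<rho> h = \<psi> h g \<bullet> \<rho> h \<triangleright> \<eta>" for \<eta> \<xi>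
    using beta_unique[OF g h, folded c_def] that g c by (simp add: char_space_cell)
  have "\<beta> g h (\<eta> \<oplus>\<^bsub>X g\<^esub> \<eta>') = \<beta> g h \<eta> \<oplus>\<^bsub>X c\<^esub> \<beta> g h \<eta>'"
    if "\<eta> \<in> carrier (X g)" "\<eta>' \<in> carrier (X g)" for \<eta> \<eta>'
    using that b by (intro u) (simp_all add: linear_mapD(2)[OF l] linear_mapD(2)[OF r])
  moreover have "\<beta> g h (a \<odot>\<^bsub>X g\<^esub> \<eta>) = a \<odot>\<^bsub>X c\<^esub> \<beta> g h \<eta>"
    if "a \<in> carrier K" "\<eta> \<in> carrier (X g)" for a \<eta>
    using that b by (intro u) (simp_all add: linear_mapD(3)[OF l] linear_mapD(3)[OF r])
  ultimately show ?thesis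
    using b(1) by (auto simp: linear_map_def c_def)
qed

text \<open>The scalar of the composition law is the inverse of the transgression.\<close>

lemma beta_comp_transgression:
  assumes r: "r \<in> carrier G" and g: "g \<in> carrier G" and h: "h \<in> carrier G" and \<eta>: "\<eta> \<in> carrier (X r)"
    and r': "conjugate G g r = r'" and r'': "conjugate G h r' = r''"
  shows "\<beta> r' h (\<beta> r g \<eta>) = transgression K \<alpha> r r' r'' g h \<odot>\<^bsub>X r''\<^esub> \<beta> r (h \<otimes>\<^bsub>G\<^esub> g) \<eta>"
proof -
  have c: "r' \<in> carrier G" "r'' \<in> carrier G" "h \<otimes>\<^bsub>G\<^esub> g \<in> carrier G"
    using r g h r' r'' by auto
  interpret M: module K "X r''" using module_char_space[OF c(2)] .
  have u: "\<alpha> h r' g \<in> Units K" "\<alpha> r'' h g \<in> Units K" "\<alpha> h g r \<in> Units K"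
    using unit_valued r g h c by auto
  define \<sigma> where "\<sigma> = \<alpha> h r' g \<otimes>\<^bsub>K\<^esub> inv\<^bsub>K\<^esub> (\<alpha> r'' h g \<otimes>\<^bsub>K\<^esub> \<alpha> h g r)"
  define \<tau> where "\<tau> = transgression K \<alpha> r r' r'' g h"
  have \<sigma>: "\<sigma> \<in> carrier K" and \<tau>: "\<tau> \<in> carrier K"
    using u transgression_Units r g h c scalar_units by (auto simp: \<sigma>_def \<tau>_def)
  have "\<tau> \<otimes>\<^bsub>K\<^esub> \<sigma> = (\<alpha> r'' h g \<otimes>\<^bsub>K\<^esub> \<alpha> h g r \<otimes>\<^bsub>K\<^esub> inv\<^bsub>K\<^esub> (\<alpha> r'' h g \<otimes>\<^bsub>K\<^esub> \<alpha> h g r))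
      \<otimes>\<^bsub>K\<^esub> (\<alpha> h r' g \<otimes>\<^bsub>K\<^esub> inv\<^bsub>K\<^esub> (\<alpha> h r' g))"
    using u scalar_units(2)[OF u(2,3)] unfolding \<tau>_def \<sigma>_def transgression_def
    by (simp add: scalar_units m_ac del: scalar_units_r_inv)
  then have one: "\<tau> \<otimes>\<^bsub>K\<^esub> \<sigma> = \<one>\<^bsub>K\<^esub>"
    using u scalar_units(2)[OF u(2,3)] by simp
  have b: "\<beta> r' h (\<beta> r g \<eta>) \<in> carrier (X r'')"
    using linear_mapD(1)[OF linear_map_beta] r g h c r' r'' \<eta> by blast
  have "\<beta> r (h \<otimes>\<^bsub>G\<^esub> g) \<eta> = \<sigma> \<odot>\<^bsub>X r''\<^esub> \<beta> r' h (\<beta> r g \<eta>)"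
    using beta_comp[OF r g h, of \<eta>] \<eta> r' r'' by (simp add: char_space_cell[OF r] \<sigma>_def) (simp add: char_space_def)
  then show ?thesis
    using M.smult_assoc1[OF \<tau> \<sigma> b] one b by (simp add: \<tau>_def)
qed

text \<open>Composing with the map for h\<inverse>, in either order, gives by the composition law a
  transgression times the map for the unit of \<open>G\<close>, which is the identity. The two
  orders involve the possibly different scalars \<tau> and \<tau>', both of them units.\<close>

lemma linear_iso_beta:
  assumes g: "g \<in> carrier G" and h: "h \<in> carrier G"
  shows "linear_iso K (X g) (X (conjugate G h g)) (\<beta> g h)"
proof -
  define c where "c = conjugate G h g"
  define \<tau> where "\<tau> = transgression K \<alpha> g c g h (inv\<^bsub>G\<^esub> h)"
  define \<tau>' where "\<tau>' = transgression K \<alpha> c g c (inv\<^bsub>G\<^esub> h) h"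
  have G: "c \<in> carrier G" "inv\<^bsub>G\<^esub> h \<in> carrier G" using g h by (simp_all add: c_def)
  have c': "conjugate G (inv\<^bsub>G\<^esub> h) c = g"
    using conjugate_conjugate[OF g h G(2)] conjugate_one[OF g] h by (simp add: c_def)
  have c: "conjugate G h g = c" by (simp add: c_def)
  interpret Xg: module K "X g" using module_char_space[OF g] .
  interpret Xc: module K "X c" using module_char_space[OF G(1)] .
  note l = linear_map_beta[OF g h, unfolded c] and l' = linear_map_beta[OF G, unfolded c']
  have u: "\<tau> \<in> Units K" "\<tau>' \<in> Units K"
    using transgression_Units g h G by (simp_all add: \<tau>_def \<tau>'_def)
  \<comment> \<open>A left inverse, for injectivity.\<close>
  have left: "\<eta> = inv\<^bsub>K\<^esub> \<tau> \<odot>\<^bsub>X g\<^esub> \<beta> c (inv\<^bsub>G\<^esub> h) (\<beta> g h \<eta>)" if \<eta>: "\<eta> \<in> carrier (X g)" for \<eta>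
    using beta_comp_transgression[OF g h G(2) \<eta> c c'] beta_one[OF g] \<eta> g h u(1)
    by (simp add: \<tau>_def[symmetric] char_space_cell[symmetric] Xg.smult_Units_inv)
  \<comment> \<open>A preimage, for surjectivity; linearity allows the scalar to be placed inside
    \<beta>.\<close>
  have right: "\<xi> = \<beta> g h (inv\<^bsub>K\<^esub> \<tau>' \<odot>\<^bsub>X g\<^esub> \<beta> c (inv\<^bsub>G\<^esub> h) \<xi>)" if \<xi>: "\<xi> \<in> carrier (X c)" for \<xi>
    using beta_comp_transgression[OF G h \<xi> c' c] beta_one[OF G(1)] \<xi> G h u(2)
      linear_mapD(3)[OF l] linear_mapD(1)[OF l' \<xi>]
    by (simp add: \<tau>'_def[symmetric] char_space_cell[symmetric] Xc.smult_Units_inv scalar_units)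
  have "bij_betw (\<beta> g h) (carrier (X g)) (carrier (X c))"
    using left right linear_mapD(1)[OF l] linear_mapD(1)[OF l'] u
    by (intro bij_betwI'[where f = "\<beta> g h"]) (metis scalar_units(4) Xg.smult_closed)+
  then show ?thesis
    using l by (simp add: linear_iso_def c)
qed

lemma beta_comp_char_space:
  assumes "r \<in> carrier G" "g \<in> carrier G" "h \<in> carrier G" "\<eta> \<in> carrier (X r)"
  shows "(\<alpha> h (conjugate G g r) g
      \<otimes>\<^bsub>K\<^esub> inv\<^bsub>K\<^esub> (\<alpha> (conjugate G h (conjugate G g r)) h g \<otimes>\<^bsub>K\<^esub> \<alpha> h g r))
    \<odot>\<^bsub>X (conjugate G h (conjugate G g r))\<^esub> \<beta> (conjugate G g r) h (\<beta> r g \<eta>)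
    = \<beta> r (h \<otimes>\<^bsub>G\<^esub> g) \<eta>"
  using beta_comp[of r g h \<eta>] assms by (simp only: char_space_cell) (simp only: char_space_def)

text \<open>The factor built into composition in the extension is exactly the one by which \<beta>
  fails to be multiplicative. The unit law yields both the preservation of identities and the scalar
  action of the centre.\<close>

lemma inertia_representation_character:
  "inertia_representation K G \<alpha> X (\<lambda>g g' (a, h). \<lambda>\<eta> \<in> carrier (X g). a \<odot>\<^bsub>X g'\<^esub> \<beta> g h \<eta>)"
proof (intro inertia_representation.intro cat_functor.intro category_inertia_extension category_vect
    cat_functor_axioms.intro inertia_representation_axioms.intro)
  fix g
  assume "g \<in> Ob (inertia_extension K G \<alpha>)"
  then have g: "g \<in> carrier G" by (simp add: inertia_extension_def)
  interpret Xg: module K "X g" using module_char_space[OF g] .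
  show "X g \<in> Ob (vect K)"
    using module_char_space[OF g] by (simp add: vect_def)
  show "(case Idt (inertia_extension K G \<alpha>) g of (a, h) \<Rightarrow> \<lambda>\<eta> \<in> carrier (X g). a \<odot>\<^bsub>X g\<^esub> \<beta> g h \<eta>)
      = Idt (vect K) (X g)"
    using beta_one[OF g] by (auto simp: inertia_extension_def vect_def char_space_cell[OF g, symmetric])
next
  fix g h f
  assume "g \<in> Ob (inertia_extension K G \<alpha>)" "h \<in> Ob (inertia_extension K G \<alpha>)"
    "f \<in> Hom (inertia_extension K G \<alpha>) g h"
  then obtain a s where f: "f = (a, s)" "a \<in> Units K" "s \<in> inertia_hom G g h"
    and G: "g \<in> carrier G" "h \<in> carrier G"
    by (auto simp: inertia_extension_def)
  note s = inertia_homD[OF f(3) G(1)]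
  show "(case f of (a, s) \<Rightarrow> \<lambda>\<eta> \<in> carrier (X g). a \<odot>\<^bsub>X h\<^esub> \<beta> g s \<eta>) \<in> Hom (vect K) (X g) (X h)"
    using linear_map_restrict[OF module_char_space[OF G(1)]
        linear_map_smult[OF module_char_space[OF G(2)] linear_map_beta[OF G(1) s(1), unfolded s(2)]]] f
    by (simp add: vect_def scalar_units)
next
  fix g h k f f'
  assume "g \<in> Ob (inertia_extension K G \<alpha>)" "h \<in> Ob (inertia_extension K G \<alpha>)"
    "k \<in> Ob (inertia_extension K G \<alpha>)" "f \<in> Hom (inertia_extension K G \<alpha>) g h"
    "f' \<in> Hom (inertia_extension K G \<alpha>) h k"
  then obtain a s b t where f: "f = (a, s)" "a \<in> Units K" "s \<in> inertia_hom G g h"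
    and f': "f' = (b, t)" "b \<in> Units K" "t \<in> inertia_hom G h k"
    and G: "g \<in> carrier G" "h \<in> carrier G" "k \<in> carrier G"
    by (auto simp: inertia_extension_def)
  note s = inertia_homD[OF f(3) G(1)] and t = inertia_homD[OF f'(3) G(2)]
  interpret Xh: module K "X h" using module_char_space[OF G(2)] .
  interpret Xk: module K "X k" using module_char_space[OF G(3)] .
  note ls = linear_map_beta[OF G(1) s(1), unfolded s(2)] and lt = linear_map_beta[OF G(2) t(1), unfolded t(2)]
  define \<tau> where "\<tau> = transgression K \<alpha> g h k s t"
  have K: "\<tau> \<in> carrier K" "a \<in> carrier K" "b \<in> carrier K"
    using transgression_Units G s(1) t(1) f(2) f'(2) by (auto simp: \<tau>_def scalar_units)
  \<comment> \<open>Equality of arrows in \<open>vect\<close> is pointwise on the carrier, where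
    linearity pulls \<open>a\<close> out of the outer map and leaves a product of scalars to
    reorder.\<close>
  have "(\<tau> \<otimes>\<^bsub>K\<^esub> (a \<otimes>\<^bsub>K\<^esub> b)) \<odot>\<^bsub>X k\<^esub> \<beta> g (t \<otimes>\<^bsub>G\<^esub> s) \<eta> = b \<odot>\<^bsub>X k\<^esub> \<beta> h t (a \<odot>\<^bsub>X h\<^esub> \<beta> g s \<eta>)"
    if \<eta>: "\<eta> \<in> carrier (X g)" for \<eta>
  proof -
    have n: "\<beta> g (t \<otimes>\<^bsub>G\<^esub> s) \<eta> \<in> carrier (X k)"
      using linear_mapD(1)[OF linear_map_beta \<eta>] inertia_homD(1,2)[OF inertia_hom_mult[OF f(3) f'(3) G(1)] G(1)] G
      by metis
    have "b \<odot>\<^bsub>X k\<^esub> \<beta> h t (a \<odot>\<^bsub>X h\<^esub> \<beta> g s \<eta>) = b \<odot>\<^bsub>X k\<^esub> (a \<odot>\<^bsub>X k\<^esub> \<beta> h t (\<beta> g s \<eta>))"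
      using linear_mapD(3)[OF lt K(2) linear_mapD(1)[OF ls \<eta>]] by simp
    also have "\<dots> = b \<odot>\<^bsub>X k\<^esub> (a \<odot>\<^bsub>X k\<^esub> (\<tau> \<odot>\<^bsub>X k\<^esub> \<beta> g (t \<otimes>\<^bsub>G\<^esub> s) \<eta>))"
      using beta_comp_transgression[OF G(1) s(1) t(1) \<eta> s(2) t(2)] by (simp add: \<tau>_def)
    also have "\<dots> = (b \<otimes>\<^bsub>K\<^esub> (a \<otimes>\<^bsub>K\<^esub> \<tau>)) \<odot>\<^bsub>X k\<^esub> \<beta> g (t \<otimes>\<^bsub>G\<^esub> s) \<eta>"
      using K n by (simp add: Xk.smult_assoc1)
    also have "b \<otimes>\<^bsub>K\<^esub> (a \<otimes>\<^bsub>K\<^esub> \<tau>) = \<tau> \<otimes>\<^bsub>K\<^esub> (a \<otimes>\<^bsub>K\<^esub> b)"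
      using K by algebra
    finally show ?thesis ..
  qed
  moreover have "a \<odot>\<^bsub>X h\<^esub> \<beta> g s \<eta> \<in> carrier (X h)" if "\<eta> \<in> carrier (X g)" for \<eta>
    using linear_mapD(1)[OF ls that] K by simp
  ultimately show "(case Cmp (inertia_extension K G \<alpha>) g h k f' f of
        (a, s) \<Rightarrow> \<lambda>\<eta> \<in> carrier (X g). a \<odot>\<^bsub>X k\<^esub> \<beta> g s \<eta>)
      = Cmp (vect K) (X g) (X h) (X k) (case f' of (a, s) \<Rightarrow> \<lambda>\<eta> \<in> carrier (X h). a \<odot>\<^bsub>X k\<^esub> \<beta> h s \<eta>)
          (case f of (a, s) \<Rightarrow> \<lambda>\<eta> \<in> carrier (X g). a \<odot>\<^bsub>X h\<^esub> \<beta> g s \<eta>)"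
    by (auto simp: inertia_extension_def vect_def compose_def f(1) f'(1) \<tau>_def fun_eq_iff)
next
  fix g a \<eta>
  assume "g \<in> carrier G" "a \<in> Units K" "\<eta> \<in> carrier (X g)"
  then show "(case (a, \<one>\<^bsub>G\<^esub>) of (a, h) \<Rightarrow> \<lambda>\<eta> \<in> carrier (X g). a \<odot>\<^bsub>X g\<^esub> \<beta> g h \<eta>) \<eta> = a \<odot>\<^bsub>X g\<^esub> \<eta>"
    using beta_one by (simp add: char_space_cell)
qed

end

theorem mainTheorem1:
  fixes K :: "('k, 'm) ring_scheme"
    and G :: "('g, 'n) monoid_scheme"
    and \<alpha> :: "'g \<Rightarrow> 'g \<Rightarrow> 'g \<Rightarrow> 'k"
    and C :: "('o, 'f, 'k, 'c, 'z) two_cat_scheme"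
    and V :: 'o
    and \<rho> :: "'g \<Rightarrow> 'f"
    and \<psi> :: "'g \<Rightarrow> 'g \<Rightarrow> 'c"
    and \<psi>1 :: 'c
  defines "X \<equiv> char_space C V \<rho>"
    and "\<beta> \<equiv> char_map G C V \<rho> \<psi> \<psi>1"
  assumes "field K"
    and "group G" and "finite (carrier G)"
    and "normalised_3_cocycle K G \<alpha>"
    and "linear_2_category K C"
    and "V \<in> Obj C"
    and "linear_representation K G \<alpha> C V \<rho> \<psi> \<psi>1"
  shows "inertia_representation K G \<alpha> X (\<lambda>g g' (a, h). \<lambda>\<eta> \<in> carrier (X g). a \<odot>\<^bsub>X g'\<^esub> \<beta> g h \<eta>)
    \<and> (\<forall>g \<in> carrier G. \<forall>h \<in> carrier G. linear_iso K (X g) (X (conjugate G h g)) (\<beta> g h))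
    \<and> (\<forall>g \<in> carrier G. \<forall>\<eta> \<in> carrier (X g). \<beta> g \<one>\<^bsub>G\<^esub> \<eta> = \<eta>)
    \<and> (\<forall>r \<in> carrier G. \<forall>g \<in> carrier G. \<forall>h \<in> carrier G. \<forall>\<eta> \<in> carrier (X r).
        (\<alpha> h (conjugate G g r) g
          \<otimes>\<^bsub>K\<^esub> inv\<^bsub>K\<^esub> (\<alpha> (conjugate G h (conjugate G g r)) h g \<otimes>\<^bsub>K\<^esub> \<alpha> h g r))
          \<odot>\<^bsub>X (conjugate G h (conjugate G g r))\<^esub> \<beta> (conjugate G g r) h (\<beta> r g \<eta>)
        = \<beta> r (h \<otimes>\<^bsub>G\<^esub> g) \<eta>)"
proof -
  interpret character_of_representation K G \<alpha> C V \<rho> \<psi> \<psi>1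
    using assms(9) by (rule character_of_representation.intro)
  show ?thesis
    unfolding assms(1,2)
    using inertia_representation_character linear_iso_beta beta_one beta_comp_char_space
    by (simp add: char_space_cell)
qed

end
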